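(* There is $n_0$ such that for every even $n\ge n_0$ the following is true: in the strong $(2:2)$ Hamilton cycle game on $E(K_n)$, Red (the first player) has a strategy to win within $n/2+1$ rounds, against any strategy of Blue.
   Context: In the strong $(2:2)$ Hamilton cycle game the board is the edge set of the complete graph $K_n$ and the winning sets are the edge sets of all Hamilton cycles of $K_n$. Two players, Red and Blue, alternately claim $2$ previously unclaimed edges per move, with Red moving first. The winner is the first player who has claimed all elements of some winning set (this may happen before the player has used both steps of a move); if neither player does so before all edges are claimed, the game is a draw. A round consists of a move of Red followed by a move of Blue (the last round may consist of Red's move only); Red wins within $t$ rounds if she wins by completing a winning set no later than in her $t$-th move. *)

theory Defs
  imports Main
begin

definition complete_edges :: "nat \<Rightarrow> nat set set" where
  "complete_edges n = {e. e \<subseteq> {..<n} \<and> card e = 2}"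

definition cycle_edges :: "'v list \<Rightarrow> 'v set set" where
  "cycle_edges vs = {{vs ! i, vs ! (Suc i mod length vs)} |i. i < length vs}"

definition hamilton_cycles :: "nat \<Rightarrow> nat set set set" where
  "hamilton_cycles n =
     {cycle_edges vs |vs. distinct vs \<and> set vs = {..<n} \<and> length vs \<ge> 3}"

text \<open>
  The strong (2:2) game on a board \<open>X\<close> with family \<open>W\<close> of winning sets.  A history is the list of
  all elements claimed so far, in the order in which they were claimed; the two steps of a move
  are recorded individually, so that the game can end after the first of them.
  The element claimed at (0-based) step \<open>k\<close> belongs to Red if \<open>k mod 4\<close> is 0 or 1 and to Blue
  otherwise.
\<close>

definition red_turn :: "nat \<Rightarrow> bool" where
  "red_turn k \<longleftrightarrow> k mod 4 < 2"

definition red_claimed :: "'a list \<Rightarrow> 'a set" where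
  "red_claimed h = {h ! k |k. k < length h \<and> red_turn k}"

definition blue_claimed :: "'a list \<Rightarrow> 'a set" where
  "blue_claimed h = {h ! k |k. k < length h \<and> \<not> red_turn k}"

definition completed :: "'a set set \<Rightarrow> 'a set \<Rightarrow> bool" where
  "completed W C \<longleftrightarrow> (\<exists>A\<in>W. A \<subseteq> C)"

text \<open>
  The legal histories after which the game is not over.  Since claimed sets only grow,
  no earlier stage of such a history can have been decided either.
\<close>

definition ongoing :: "'a set \<Rightarrow> 'a set set \<Rightarrow> 'a list \<Rightarrow> bool" where
  "ongoing X W h \<longleftrightarrow> distinct h \<and> set h \<subset> X \<and>
     \<not> completed W (red_claimed h) \<and> \<not> completed W (blue_claimed h)"

type_synonym 'a strategy = "'a list \<Rightarrow> 'a"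

definition red_strategy :: "'a set \<Rightarrow> 'a set set \<Rightarrow> 'a strategy \<Rightarrow> bool" where
  "red_strategy X W \<sigma> \<longleftrightarrow>
     (\<forall>h. ongoing X W h \<and> red_turn (length h) \<longrightarrow> \<sigma> h \<in> X - set h)"

definition blue_strategy :: "'a set \<Rightarrow> 'a set set \<Rightarrow> 'a strategy \<Rightarrow> bool" where
  "blue_strategy X W \<tau> \<longleftrightarrow>
     (\<forall>h. ongoing X W h \<and> \<not> red_turn (length h) \<longrightarrow> \<tau> h \<in> X - set h)"

primrec play :: "'a set \<Rightarrow> 'a set set \<Rightarrow> 'a strategy \<Rightarrow> 'a strategy \<Rightarrow> nat \<Rightarrow> 'a list" where
  "play X W \<sigma> \<tau> 0 = []"
| "play X W \<sigma> \<tau> (Suc k) =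
     (let h = play X W \<sigma> \<tau> k in
      if ongoing X W h then h @ [if red_turn (length h) then \<sigma> h else \<tau> h] else h)"

text \<open>
  Red's \<open>t\<close>-th move ends after \<open>4 * (t - 1) + 2 = 4 * t - 2\<close> steps.  As the play is frozen as soon
  as one of the players has completed a winning set, a winning set inside Red's claimed elements
  means that Red was the first to complete one.
\<close>

definition red_wins_within ::
    "'a set \<Rightarrow> 'a set set \<Rightarrow> nat \<Rightarrow> 'a strategy \<Rightarrow> 'a strategy \<Rightarrow> bool" where
  "red_wins_within X W t \<sigma> \<tau> \<longleftrightarrow> completed W (red_claimed (play X W \<sigma> \<tau> (4 * t - 2)))"

end

theory Submission
  imports Defs
begin

text \<open>
  Red builds a linear forest, always joining ends of two different paths, until two paths are left
  after \<open>n / 2 - 1\<close> rounds.  Blue can be faster than \<open>n / 2 + 1\<close> rounds only if all of his first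
  \<open>n\<close> edges lie on one Hamilton cycle; once this has become impossible (he has \<^emph>\<open>wasted\<close> an edge),
  Red may herself waste one edge: she makes a Hamilton path and closes it by a rotation.

  Let \<open>k\<close> be the number of paths and \<open>e\<close> the number of Blue edges between ends of paths.  Joining
  ends of high Blue degree, Red reaches \<open>e \<le> k\<close> and then keeps it before each of her moves: a move
  kills four such edges and lowers \<open>k\<close> by two, whereas Blue adds only two.  So no Blue edge joins the four
  ends when \<open>k = 2\<close>.  If moreover every end is already touched by Blue, he cannot
  block both ways of closing Red's two paths to a cycle without wasting an edge.  Beforehand Red gets
  rid of isolated vertices, of ends of linear Blue degree (needed for the rotation), and, as long as
  Blue has not wasted an edge and hence has maximum degree at most two, of ends untouched by Blue.
\<close>

section \<open>From positions to strategies\<close>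

text \<open>Red's budget is \<open>2 * n + 2\<close> steps, hence \<open>n + 2\<close> edges: a
  Hamilton path of \<open>n - 1\<close> edges, one spare edge and the two new edges of a rotation.
  Isolated vertices are an obstacle because such a vertex stays an end after its first join; without
  them \<open>k\<close> paths have exactly \<open>2 * k\<close> ends, and every join removes two
  ends together with all Blue edges at them. Each preliminary goal is paid for by a potential
  compared with \<open>2 * k\<close>, so that linearly many paths are left when \<open>e\<close> has
  to be brought down. At that point \<open>e\<close> is below \<open>3 * k\<close> by a margin, and
  joins that kill four edges preserve the margin until \<open>e\<close> is close to
  \<open>k\<close>. Evenness of \<open>n\<close> makes \<open>k = 2\<close> occur at the end of a
  Red move. The phases are proved in reverse order, since each one ends in a position won by the
  next.\<close>

text \<open>\<open>m\<close> steps remain and \<open>l\<close> have been made; a position is a pair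
  of sets, so the order of past claims is forgotten. In the Blue case
  \<open>R \<union> B \<subset> X\<close> is demanded because on a full board, that is, in a draw,
  the universal quantifier would hold vacuously.\<close>

primrec forces :: "'a set \<Rightarrow> 'a set set \<Rightarrow> nat \<Rightarrow> nat \<Rightarrow> 'a set \<Rightarrow> 'a set \<Rightarrow> bool" where
  "forces X W 0 l R B = completed W R"
| "forces X W (Suc m) l R B = (completed W R \<or> \<not> completed W B \<and>
     (if red_turn l then \<exists>e\<in>X - (R \<union> B). forces X W m (Suc l) (insert e R) B
      else R \<union> B \<subset> X \<and> (\<forall>e\<in>X - (R \<union> B). forces X W m (Suc l) R (insert e B))))"

lemma forces_completed: "completed W R \<Longrightarrow> forces X W m l R B"
  by (cases m) auto

lemma red_claimed_image: "red_claimed h = (!) h ` {k. k < length h \<and> red_turn k}"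
  by (auto simp: red_claimed_def)

lemma blue_claimed_image: "blue_claimed h = (!) h ` {k. k < length h \<and> \<not> red_turn k}"
  by (auto simp: blue_claimed_def)

lemma image_nth_append:
  "(!) (h @ [e]) ` {k. k < length (h @ [e]) \<and> P k} =
     (if P (length h) then insert e else id) ((!) h ` {k. k < length h \<and> P k})"
proof -
  have "{k. k < length (h @ [e]) \<and> P k} =
      (if P (length h) then insert (length h) else id) {k. k < length h \<and> P k}"
    by (auto simp: less_Suc_eq)
  moreover have "(!) (h @ [e]) ` {k. k < length h \<and> P k} = (!) h ` {k. k < length h \<and> P k}"
    by (rule image_cong) (auto simp: nth_append)
  ultimately show ?thesis by simp
qed

lemma red_claimed_append:
  "red_claimed (h @ [e]) = (if red_turn (length h) then insert e (red_claimed h) else red_claimed h)"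
  unfolding red_claimed_image image_nth_append by simp

lemma blue_claimed_append:
  "blue_claimed (h @ [e]) = (if red_turn (length h) then blue_claimed h else insert e (blue_claimed h))"
  unfolding blue_claimed_image image_nth_append by simp

lemma claimed_Un: "red_claimed h \<union> blue_claimed h = set h"
proof -
  have "{k. k < length h \<and> red_turn k} \<union> {k. k < length h \<and> \<not> red_turn k} = {..<length h}" by auto
  then show ?thesis
    unfolding red_claimed_image blue_claimed_image
    by (metis image_Un lessThan_atLeast0 list.set_map map_nth set_upt)
qed

lemma forces_imp_strategy:
  assumes "forces X W N 0 {} {}"
  shows "\<exists>\<sigma>. red_strategy X W \<sigma> \<and>
    (\<forall>\<tau>. blue_strategy X W \<tau> \<longrightarrow> completed W (red_claimed (play X W \<sigma> \<tau> N)))"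
proof -
  define good where "good h e \<longleftrightarrow> e \<in> X - set h \<and>
    forces X W (N - Suc (length h)) (Suc (length h)) (insert e (red_claimed h)) (blue_claimed h)" for h e
  \<comment> \<open>The second default is needed because a strategy must answer legally in every
    ongoing history, also in those from which Red cannot force a win.\<close>
  define \<sigma> where "\<sigma> h = (if \<exists>e. good h e then SOME e. good h e else SOME e. e \<in> X - set h)" for h
  have "red_strategy X W \<sigma>"
    unfolding red_strategy_def
  proof (intro allI impI)
    fix h assume "ongoing X W h \<and> red_turn (length h)"
    then have "\<exists>e. e \<in> X - set h" unfolding ongoing_def by blast
    then have 1: "(SOME e. e \<in> X - set h) \<in> X - set h" by (rule someI_ex)
    have 2: "good h (SOME e. good h e)" if "\<exists>e. good h e" using that by (rule someI_ex)
    show "\<sigma> h \<in> X - set h"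
      using 1 2 unfolding \<sigma>_def good_def by (smt (verit, best))
  qed
  moreover have "completed W (red_claimed (play X W \<sigma> \<tau> N))" if bs: "blue_strategy X W \<tau>" for \<tau>
  proof -
    \<comment> \<open>Invariant along the play: once Red has completed a winning set the play is
      frozen; until then exactly \<open>k\<close> steps have been made and the rest of the win is
      still forced.\<close>
    have "k \<le> N \<Longrightarrow> (let h = play X W \<sigma> \<tau> k in completed W (red_claimed h) \<or>
        length h = k \<and> distinct h \<and> set h \<subseteq> X \<and>
        forces X W (N - k) k (red_claimed h) (blue_claimed h))" for k
    proof (induction k)
      case 0
      then show ?case using assms by (simp add: red_claimed_def blue_claimed_def)
    next
      case (Suc k)
      define h where "h = play X W \<sigma> \<tau> k"
      show ?case
      proof (cases "completed W (red_claimed h)")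
        case True
        then have "\<not> ongoing X W h" by (simp add: ongoing_def)
        then show ?thesis using True by (simp add: h_def)
      next
        case False
        have IH: "length h = k" "distinct h" "set h \<subseteq> X"
            "forces X W (N - k) k (red_claimed h) (blue_claimed h)"
          using Suc False by (auto simp: h_def Let_def)
        define m where "m = N - Suc k"
        have m: "N - k = Suc m" using Suc.prems by (simp add: m_def)
        note f = IH(4)[unfolded m forces.simps claimed_Un]
        have nb: "\<not> completed W (blue_claimed h)" using f False by blast
        have sub: "set h \<subset> X" using f False IH(3) by (auto split: if_splits)
        have og: "ongoing X W h" unfolding ongoing_def using IH nb sub False by blast
        show ?thesis
        proof (cases "red_turn k")
          case True
          then have "\<exists>e. good h e" using f False IH(1) by (auto simp: good_def m_def)
          then have "good h (\<sigma> h)" unfolding \<sigma>_def by (simp add: someI_ex)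
          then show ?thesis using True og IH
            by (auto simp: h_def[symmetric] Let_def good_def red_claimed_append blue_claimed_append)
        next
          case c: False
          have "\<tau> h \<in> X - set h" using bs og c IH(1) unfolding blue_strategy_def by blast
          then show ?thesis using c og IH f False
            by (auto simp: h_def[symmetric] Let_def red_claimed_append blue_claimed_append m_def)
        qed
      qed
    qed
    from this[of N] show ?thesis by (auto simp: Let_def)
  qed
  ultimately show ?thesis by blast
qed

section \<open>Hamilton cycles and degrees\<close>

definition deg :: "'a set set \<Rightarrow> 'a \<Rightarrow> nat" where
  "deg B v = card {b \<in> B. v \<in> b}"

definition inner :: "'a set set \<Rightarrow> 'a set \<Rightarrow> 'a set set" where
  "inner B E = {b \<in> B. b \<subseteq> E}"

lemma finite_complete_edges [simp]: "finite (complete_edges n)"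
  unfolding complete_edges_def by (rule finite_subset[of _ "Pow {..<n}"]) auto

lemma card_complete_edges: "card (complete_edges n) = n choose 2"
  unfolding complete_edges_def using n_subsets[of "{..<n}" 2] by simp

lemma finite_blue: "B \<subseteq> complete_edges n \<Longrightarrow> finite B"
  using finite_subset finite_complete_edges by blast

lemma deg_mono: "finite B \<Longrightarrow> A \<subseteq> B \<Longrightarrow> deg A v \<le> deg B v"
  unfolding deg_def by (rule card_mono) auto

lemma deg_le_card: "finite B \<Longrightarrow> deg B v \<le> card B"
  unfolding deg_def by (rule card_mono) auto

lemma deg_diff:
  assumes "finite B" "A \<subseteq> B"
  shows "deg B v = deg A v + deg (B - A) v"
proof -
  have "{b \<in> B. v \<in> b} = {b \<in> A. v \<in> b} \<union> {b \<in> B - A. v \<in> b}" using assms by auto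
  moreover have "card \<dots> = card {b \<in> A. v \<in> b} + card {b \<in> B - A. v \<in> b}"
    using assms by (intro card_Un_disjoint) (auto intro: finite_subset)
  ultimately show ?thesis by (simp add: deg_def)
qed

lemma sum_deg:
  assumes "finite B" "finite E" "\<And>b. b \<in> B \<Longrightarrow> b \<subseteq> E \<and> card b = 2"
  shows "(\<Sum>v\<in>E. deg B v) = 2 * card B"
proof -
  have "(\<Sum>v\<in>E. deg B v) = (\<Sum>v\<in>E. \<Sum>b\<in>B. if v \<in> b then 1 else 0)"
    unfolding deg_def card_eq_sum using assms by (intro sum.cong sum.inter_filter refl)
  also have "\<dots> = (\<Sum>b\<in>B. \<Sum>v\<in>E. if v \<in> b then 1 else 0)" by (rule sum.swap)
  also have "\<dots> = (\<Sum>b\<in>B. 2)"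
  proof (rule sum.cong)
    fix b assume "b \<in> B"
    then have "E \<inter> {v. v \<in> b} = b" "card b = 2" using assms by auto
    then show "(\<Sum>v\<in>E. if v \<in> b then 1 else 0) = (2::nat)" using assms(2)
      by (simp add: sum.If_cases)
  qed simp
  finally show ?thesis by simp
qed

lemma sum_deg_le:
  assumes "B \<subseteq> complete_edges n" "K \<subseteq> {..<n}"
  shows "(\<Sum>v\<in>K. deg B v) \<le> 2 * card B"
proof -
  have "(\<Sum>v\<in>K. deg B v) \<le> (\<Sum>v<n. deg B v)" using assms by (intro sum_mono2) auto
  also have "\<dots> = 2 * card B"
    using assms finite_blue[OF assms(1)] by (intro sum_deg) (auto simp: complete_edges_def)
  finally show ?thesis .
qed

text \<open>As \<open>{u, w}\<close> is not in \<open>B\<close>, no edge is counted by both degrees.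
  This is the effect of joining the ends \<open>u\<close> and \<open>w\<close> on the number of Blue
  edges between ends.\<close>

lemma inner_remove:
  assumes "finite B" "u \<in> E" "w \<in> E" "u \<noteq> w" "{u, w} \<notin> B" "\<And>b. b \<in> B \<Longrightarrow> card b = 2"
  shows "card (inner B E) = card (inner B (E - {u, w})) + deg (inner B E) u + deg (inner B E) w"
proof -
  let ?A = "inner B (E - {u, w})" and ?U = "{b \<in> inner B E. u \<in> b}" and ?V = "{b \<in> inner B E. w \<in> b}"
  have fin: "finite ?A" "finite ?U" "finite ?V" using assms(1) by (auto simp: inner_def)
  have "b = {u, w}" if b: "b \<in> B" "u \<in> b" "w \<in> b" for b
  proof -
    obtain x y where "b = {x, y}" using assms(6)[OF b(1)] by (auto simp: card_2_iff)
    then show ?thesis using b assms(4) by auto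
  qed
  then have disj: "?U \<inter> ?V = {}" "?A \<inter> (?U \<union> ?V) = {}" using assms(5) by (auto simp: inner_def)
  have "inner B E = ?A \<union> (?U \<union> ?V)" by (auto simp: inner_def)
  then have "card (inner B E) = card (?A \<union> (?U \<union> ?V))" by (rule arg_cong)
  also have "\<dots> = card ?A + card (?U \<union> ?V)" using fin disj by (intro card_Un_disjoint) auto
  also have "card (?U \<union> ?V) = card ?U + card ?V" using fin disj by (intro card_Un_disjoint) auto
  finally show ?thesis by (simp add: deg_def)
qed

section \<open>Hamilton cycles as edge sets\<close>

lemma deg_cycle_le:
  assumes "distinct vs"
  shows "deg (cycle_edges vs) v \<le> 2"
proof (cases "v \<in> set vs")
  case True
  then obtain j where j: "j < length vs" "vs ! j = v" by (auto simp: in_set_conv_nth)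
  let ?n = "length vs"
  let ?e = "\<lambda>i. {vs ! i, vs ! (Suc i mod ?n)}"
  let ?j = "if j = 0 then ?n - 1 else j - 1"
  have "{b \<in> cycle_edges vs. v \<in> b} \<subseteq> {?e j, ?e ?j}"
  proof
    fix b assume "b \<in> {b \<in> cycle_edges vs. v \<in> b}"
    then obtain i where i: "i < ?n" "b = ?e i" "v \<in> ?e i" by (auto simp: cycle_edges_def)
    have p: "Suc i mod ?n < ?n" using i(1) by (intro mod_less_divisor) auto
    have "i = j \<or> Suc i mod ?n = j"
      using i j assms p by (auto simp: nth_eq_iff_index_eq)
    then show "b \<in> {?e j, ?e ?j}"
    proof
      assume "Suc i mod ?n = j"
      then have "i = ?j" using i(1) by (cases "Suc i = ?n") auto
      then show ?thesis using i by simp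
    qed (use i in simp)
  qed
  then have "card {b \<in> cycle_edges vs. v \<in> b} \<le> card {?e j, ?e ?j}" by (intro card_mono) auto
  also have "\<dots> \<le> 2" by (simp add: card_insert_if)
  finally show ?thesis by (simp add: deg_def)
next
  case False
  have "{b \<in> cycle_edges vs. v \<in> b} = {}"
  proof -
    have "vs ! i \<noteq> v \<and> vs ! (Suc i mod length vs) \<noteq> v" if "i < length vs" for i
      using False that nth_mem[of i vs] nth_mem[of "Suc i mod length vs" vs]
      by (metis gr_implies_not0 length_0_conv mod_less_divisor length_greater_0_conv)
    then show ?thesis by (auto simp: cycle_edges_def)
  qed
  then show ?thesis unfolding deg_def by (metis card.empty zero_le)
qed

text \<open>Two positions with the same edge would be cyclic successors of each other, which is
  possible only in length two.\<close>

lemma card_cycle_edges: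
  assumes "distinct vs" "length vs \<ge> 3"
  shows "card (cycle_edges vs) = length vs"
proof -
  let ?n = "length vs"
  let ?e = "\<lambda>i. {vs ! i, vs ! (Suc i mod ?n)}"
  have "inj_on ?e {..<?n}"
  proof (rule inj_onI)
    fix i j assume ij: "i \<in> {..<?n}" "j \<in> {..<?n}" "?e i = ?e j"
    show "i = j"
    proof (rule ccontr)
      assume ne: "i \<noteq> j"
      have p: "Suc i mod ?n < ?n" "Suc j mod ?n < ?n" using ij by (auto intro!: mod_less_divisor)
      have "i = Suc j mod ?n" "j = Suc i mod ?n" using ij ne assms(1) p
        by (auto simp: doubleton_eq_iff nth_eq_iff_index_eq)
      then have "i = Suc j \<or> i = 0 \<and> Suc j = ?n" "j = Suc i \<or> j = 0 \<and> Suc i = ?n"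
        using ij by (metis lessThan_iff mod_less mod_self Suc_lessI)+
      then show False using assms(2) by linarith
    qed
  qed
  moreover have "cycle_edges vs = ?e ` {..<?n}" by (auto simp: cycle_edges_def)
  ultimately show ?thesis by (simp add: card_image)
qed

lemma hamilton_cycleE:
  assumes "H \<in> hamilton_cycles n"
  obtains vs where "H = cycle_edges vs" "distinct vs" "set vs = {..<n}" "length vs = n" "n \<ge> 3"
  using assms distinct_card unfolding hamilton_cycles_def by fastforce

lemma card_hamilton_cycle: "H \<in> hamilton_cycles n \<Longrightarrow> card H = n"
  by (elim hamilton_cycleE) (auto simp: card_cycle_edges)

lemma deg_hamilton_cycle_le: "H \<in> hamilton_cycles n \<Longrightarrow> deg H v \<le> 2"
  by (elim hamilton_cycleE) (auto simp: deg_cycle_le)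

lemma finite_hamilton_cycle: "H \<in> hamilton_cycles n \<Longrightarrow> finite H"
  by (elim hamilton_cycleE) (auto simp: cycle_edges_def)

lemma not_completed_if_card_less:
  "finite R \<Longrightarrow> card R < n \<Longrightarrow> \<not> completed (hamilton_cycles n) R"
  unfolding completed_def using card_hamilton_cycle card_mono by (metis leD)

definition wasted :: "nat \<Rightarrow> nat set set \<Rightarrow> bool" where
  "wasted n B \<longleftrightarrow> \<not> (\<exists>H\<in>hamilton_cycles n. B \<subseteq> H)"

lemma wasted_mono: "wasted n A \<Longrightarrow> A \<subseteq> B \<Longrightarrow> wasted n B"
  unfolding wasted_def by blast

lemma not_wasted_deg_le:
  assumes "\<not> wasted n B" shows "deg B v \<le> 2"
  using assms deg_mono deg_hamilton_cycle_le finite_hamilton_cycle unfolding wasted_def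
  by (metis le_trans)

text \<open>A Hamilton cycle inside at most \<open>n\<close> edges is all of them, whereas a wasted
  set lies in no Hamilton cycle.\<close>

lemma wasted_not_completed:
  assumes "wasted n B" "finite B" "card B \<le> n"
  shows "\<not> completed (hamilton_cycles n) B"
proof
  assume "completed (hamilton_cycles n) B"
  then obtain H where H: "H \<in> hamilton_cycles n" "H \<subseteq> B" by (auto simp: completed_def)
  then have "H = B" using assms card_hamilton_cycle card_seteq by metis
  then show False using assms(1) H by (auto simp: wasted_def)
qed

section \<open>Linear forests\<close>

fun pedges :: "'v list \<Rightarrow> 'v set set" where
  "pedges (x # y # zs) = insert {x, y} (pedges (y # zs))"
| "pedges _ = {}"

lemma pedges_append:
  "us \<noteq> [] \<Longrightarrow> vs \<noteq> [] \<Longrightarrow> pedges (us @ vs) = insert {last us, hd vs} (pedges us \<union> pedges vs)"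
proof (induction us rule: pedges.induct)
  case ("2_2" x)
  then show ?case by (cases vs) auto
qed auto

lemma pedges_rev [simp]: "pedges (rev p) = pedges p"
proof (induction p rule: pedges.induct)
  case (1 x y zs)
  have "pedges (rev (x # y # zs)) = pedges (rev (y # zs) @ [x])" by simp
  also have "\<dots> = insert {y, x} (pedges (rev (y # zs)) \<union> {})"
    using pedges_append[of "rev (y # zs)" "[x]"] by (simp del: rev.simps(2) add: last_rev)
  finally show ?case using 1 by (simp add: insert_commute)
qed auto

lemma pedges_subset: "e \<in> pedges p \<Longrightarrow> e \<subseteq> set p"
  by (induction p rule: pedges.induct) auto

lemma finite_pedges [simp]: "finite (pedges p)"
  by (induction p rule: pedges.induct) auto

lemma pedges_nth: "pedges p = {{p ! i, p ! Suc i} |i. Suc i < length p}"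
proof (induction p rule: pedges.induct)
  case (1 x y zs)
  have "{{(x # y # zs) ! i, (x # y # zs) ! Suc i} |i. Suc i < length (x # y # zs)}
      = insert {x, y} {{(y # zs) ! i, (y # zs) ! Suc i} |i. Suc i < length (y # zs)}"
    (is "?L = ?R")
  proof
    show "?L \<subseteq> ?R"
    proof
      fix e assume "e \<in> ?L"
      then obtain i where "e = {(x # y # zs) ! i, (x # y # zs) ! Suc i}" "Suc i < length (x # y # zs)" by auto
      then show "e \<in> ?R" by (cases i) auto
    qed
    show "?R \<subseteq> ?L"
    proof
      fix e assume "e \<in> ?R"
      then consider "e = {x, y}" | i where "e = {(y # zs) ! i, (y # zs) ! Suc i}" "Suc i < length (y # zs)" by blast
      then show "e \<in> ?L"
      proof cases
        case 1 then show ?thesis by (intro CollectI exI[of _ 0]) auto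
      next
        case 2 then show ?thesis by (intro CollectI exI[of _ "Suc i"]) auto
      qed
    qed
  qed
  then show ?case using 1 by simp
qed auto

lemma cycle_edges_eq:
  assumes "vs \<noteq> []"
  shows "cycle_edges vs = insert {last vs, hd vs} (pedges vs)"
proof -
  have "cycle_edges vs = (\<lambda>i. {vs ! i, vs ! (Suc i mod length vs)}) ` {i. i < length vs}"
    by (auto simp: cycle_edges_def)
  also have "{i. i < length vs} = insert (length vs - 1) {i. Suc i < length vs}" using assms by auto
  also have "(\<lambda>i. {vs ! i, vs ! (Suc i mod length vs)}) ` \<dots> =
      insert {vs ! (length vs - 1), vs ! 0} ((\<lambda>i. {vs ! i, vs ! Suc i}) ` {i. Suc i < length vs})"
    using assms by auto
  finally show ?thesis using assms by (auto simp add: pedges_nth last_conv_nth hd_conv_nth)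
qed

text \<open>A path is the list of its vertices, an isolated vertex a singleton list. Disjointness of
  different members also excludes that a longer path occurs together with its reversal.\<close>

definition forest :: "nat \<Rightarrow> nat list set \<Rightarrow> bool" where
  "forest n F \<longleftrightarrow> finite F \<and> (\<forall>p\<in>F. p \<noteq> [] \<and> distinct p) \<and> \<Union> (set ` F) = {..<n} \<and>
     (\<forall>p\<in>F. \<forall>q\<in>F. p \<noteq> q \<longrightarrow> set p \<inter> set q = {})"

definition red :: "'v list set \<Rightarrow> 'v set set" where "red F = \<Union> (pedges ` F)"

definition ends :: "'v list set \<Rightarrow> 'v set" where "ends F = (\<Union>p\<in>F. {hd p, last p})"

definition isos :: "'v list set \<Rightarrow> 'v set" where "isos F = {v. [v] \<in> F}"

definition connected :: "'v list set \<Rightarrow> 'v \<Rightarrow> 'v \<Rightarrow> bool" where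
  "connected F u w \<longleftrightarrow> (\<exists>p\<in>F. u \<in> set p \<and> w \<in> set p)"

lemma finite_red: "forest n F \<Longrightarrow> finite (red F)"
  by (simp add: red_def forest_def)

lemma ends_subset: "forest n F \<Longrightarrow> ends F \<subseteq> {..<n}"
  unfolding forest_def ends_def by fastforce

lemma finite_ends: "forest n F \<Longrightarrow> finite (ends F)"
  using ends_subset finite_subset by blast

lemma isos_subset_ends: "isos F \<subseteq> ends F"
  unfolding isos_def ends_def by force

lemma hd_eq_last_iff: "distinct p \<Longrightarrow> p \<noteq> [] \<Longrightarrow> hd p = last p \<longleftrightarrow> p = [hd p]"
  by (cases p) auto

text \<open>A path has two ends, except that the two coincide for an isolated vertex.\<close>

lemma card_ends_isos:
  assumes "forest n F"
  shows "card (ends F) + card (isos F) = 2 * card F"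
proof -
  note f = assms[unfolded forest_def]
  let ?g = "\<lambda>p. {hd p, last p}" and ?h = "\<lambda>p. if hd p = last p then {hd p} else {}"
  have disj: "set p \<inter> set q = {}" if "p \<in> F" "q \<in> F" "p \<noteq> q" for p q using that f by blast
  have sub: "?g p \<subseteq> set p" "?h p \<subseteq> set p" if "p \<in> F" for p using that f by auto
  have "card (\<Union>p\<in>F. ?g p) = (\<Sum>p\<in>F. card (?g p))"
  proof (rule card_UN_disjoint)
    show "\<forall>p\<in>F. \<forall>q\<in>F. p \<noteq> q \<longrightarrow> ?g p \<inter> ?g q = {}" using disj sub(1) by blast
  qed (use f in auto)
  moreover have "card (\<Union>p\<in>F. ?h p) = (\<Sum>p\<in>F. card (?h p))"
  proof (rule card_UN_disjoint)
    show "\<forall>p\<in>F. \<forall>q\<in>F. p \<noteq> q \<longrightarrow> ?h p \<inter> ?h q = {}" using disj sub(2) by blast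
  qed (use f in auto)
  moreover have "isos F = (\<Union>p\<in>F. ?h p)"
  proof -
    have "p = [v] \<longleftrightarrow> hd p = last p \<and> v = hd p" if "p \<in> F" for p v
      using that f hd_eq_last_iff[of p] by auto
    then show ?thesis by (force simp: isos_def split: if_splits)
  qed
  moreover have "(\<Sum>p\<in>F. card (?g p)) + (\<Sum>p\<in>F. card (?h p)) = (\<Sum>p\<in>F. 2)"
    unfolding sum.distrib[symmetric]
  proof (rule sum.cong)
    show "card (?g p) + card (?h p) = 2" for p by (auto simp: card_insert_if)
  qed simp
  ultimately show ?thesis unfolding ends_def by simp
qed

text \<open>\<open>u'\<close> is the other end of the path of \<open>u\<close>, and \<open>u\<close>
  itself if this path is a single vertex.\<close>

lemma mate_exists:
  assumes "forest n F" "u \<in> ends F"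
  shows "\<exists>u'. \<forall>w\<in>ends F - {u, u'}. \<not> connected F u w"
proof -
  obtain p where p: "p \<in> F" "u \<in> {hd p, last p}" using assms(2) by (auto simp: ends_def)
  have ne: "\<And>q. q \<in> F \<Longrightarrow> q \<noteq> []" using assms by (auto simp: forest_def)
  have u: "u \<in> set p" using p ne by auto
  have "w \<in> {hd p, last p}" if w: "w \<in> ends F" "connected F u w" for w
  proof -
    obtain q where q: "q \<in> F" "w \<in> {hd q, last q}" using w by (auto simp: ends_def)
    obtain r where r: "r \<in> F" "u \<in> set r" "w \<in> set r" using w by (auto simp: connected_def)
    have "w \<in> set q" using q ne by auto
    then have "q = r" "r = p" using q r p u assms(1) unfolding forest_def by blast+
    then show ?thesis using q by simp
  qed
  then have "\<forall>w\<in>ends F - {u, if u = hd p then last p else hd p}. \<not> connected F u w"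
    using p(2) by (auto split: if_splits)
  then show ?thesis by blast
qed

lemma edge_not_red: "\<not> connected F u w \<Longrightarrow> {u, w} \<notin> red F"
  unfolding red_def connected_def using pedges_subset by fastforce

text \<open>A joined vertex becomes interior only if it was not isolated; an isolated one stays an
  end, now of a longer path. This is why \<open>isos F\<close> is subtracted from the removed
  ends.\<close>

definition joins :: "nat \<Rightarrow> nat list set \<Rightarrow> nat \<Rightarrow> nat \<Rightarrow> nat list set \<Rightarrow> bool" where
  "joins n F u w F' \<longleftrightarrow> forest n F' \<and> card F = Suc (card F') \<and> red F' = insert {u, w} (red F) \<and>
     ends F' = ends F - ({u, w} - isos F) \<and> isos F' = isos F - {u, w}"

lemma reorient:
  assumes "p \<noteq> []" "u \<in> {hd p, last p}"
  obtains p' where "last p' = u" "set p' = set p" "pedges p' = pedges p" "distinct p' = distinct p"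
    "{hd p', last p'} = {hd p, last p}" "length p' = length p" "p' \<noteq> []"
proof (cases "u = last p")
  case True
  then show ?thesis using that[of p] assms by auto
next
  case False
  then show ?thesis using that[of "rev p"] assms by (auto simp: hd_rev last_rev)
qed

lemma join_exists:
  assumes F: "forest n F" and u: "u \<in> ends F" and w: "w \<in> ends F" and nc: "\<not> connected F u w"
  shows "\<exists>F'. joins n F u w F'"
proof -
  note f = F[unfolded forest_def]
  obtain p where p: "p \<in> F" "u \<in> {hd p, last p}" using u by (auto simp: ends_def)
  obtain q where q: "q \<in> F" "w \<in> {hd q, last q}" using w by (auto simp: ends_def)
  have ne: "p \<noteq> []" "q \<noteq> []" using p q f by auto
  obtain p' where p': "last p' = u" "set p' = set p" "pedges p' = pedges p" "distinct p' = distinct p"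
    "{hd p', last p'} = {hd p, last p}" "length p' = length p" "p' \<noteq> []" using reorient[OF ne(1) p(2)] by metis
  obtain q0 where q0: "last q0 = w" "set q0 = set q" "pedges q0 = pedges q" "distinct q0 = distinct q"
    "{hd q0, last q0} = {hd q, last q}" "length q0 = length q" "q0 \<noteq> []" using reorient[OF ne(2) q(2)] by metis
  define q' where "q' = rev q0"
  have q': "hd q' = w" "set q' = set q" "pedges q' = pedges q" "distinct q' = distinct q"
    "{hd q', last q'} = {hd q, last q}" "length q' = length q" "q' \<noteq> []"
    using q0 by (auto simp: q'_def hd_rev last_rev)
  have uw: "u \<in> set p" "w \<in> set q" using p q ne by auto
  have pq: "p \<noteq> q" using uw nc p by (auto simp: connected_def)
  have disj: "set p \<inter> set q = {}" using pq p q f by blast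
  define G where "G = F - {p, q}"
  \<comment> \<open>\<open>p'\<close> is oriented so that it ends in \<open>u\<close>, and
    \<open>q'\<close> so that it starts in \<open>w\<close>.\<close>
  define F' where "F' = insert (p' @ q') G"
  have FG: "F = insert p (insert q G)" using p q by (auto simp: G_def)
  have dG: "set r \<inter> set p = {}" "set r \<inter> set q = {}" if "r \<in> G" for r
    using that p q f by (auto simp: G_def)
  have neG: "r \<noteq> []" "distinct r" if "r \<in> G" for r using that f by (auto simp: G_def)
  have new: "p' @ q' \<notin> G"
  proof
    assume "p' @ q' \<in> G"
    then have "set (p' @ q') \<inter> set p = {}" by (rule dG)
    then show False using p'(2) uw by auto
  qed
  have "forest n F'"
    unfolding forest_def
  proof (intro conjI)
    show "finite F'" using f by (simp add: F'_def G_def)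
    show "\<forall>p\<in>F'. p \<noteq> [] \<and> distinct p"
      using neG p' q' disj p q f by (auto simp: F'_def)
    have "\<Union> (set ` F') = \<Union> (set ` F)" unfolding F'_def FG using p' q' by auto
    then show "\<Union> (set ` F') = {..<n}" using f by simp
    show "\<forall>r\<in>F'. \<forall>s\<in>F'. r \<noteq> s \<longrightarrow> set r \<inter> set s = {}"
    proof (intro ballI impI)
      fix r s assume rs: "r \<in> F'" "s \<in> F'" "r \<noteq> s"
      then consider "r \<in> G" "s \<in> G" | "r = p' @ q'" "s \<in> G" | "r \<in> G" "s = p' @ q'"
        by (auto simp: F'_def)
      then show "set r \<inter> set s = {}"
      proof cases
        case 1 then show ?thesis using rs(3) f by (simp add: G_def)
      next
        case 2 then show ?thesis using dG[of s] p' q' by auto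
      next
        case 3 then show ?thesis using dG[of r] p' q' by auto
      qed
    qed
  qed
  moreover have "card F = Suc (card F')"
  proof -
    have "finite G" using f by (simp add: G_def)
    moreover have "p \<notin> insert q G" "q \<notin> G" using pq by (auto simp: G_def)
    ultimately show ?thesis using new by (simp add: FG F'_def)
  qed
  moreover have "red F' = insert {u, w} (red F)"
    unfolding red_def F'_def FG using p' q' pedges_append[of p' q'] by auto
  moreover have eG: "x \<notin> set p \<union> set q" if x: "x \<in> ends G" for x
  proof -
    obtain r where r: "r \<in> G" "x \<in> {hd r, last r}" using x by (auto simp: ends_def)
    then have "x \<in> set r" using neG(1)[OF r(1)] by auto
    then show ?thesis using dG[OF r(1)] by auto
  qed
  have ip: "hd p' = u \<longleftrightarrow> u \<in> isos F"
  proof -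
    have "hd p' = u \<longleftrightarrow> p' = [u]" using hd_eq_last_iff[of p'] p' p f by auto
    also have "\<dots> \<longleftrightarrow> p = [u]" using p' uw by (cases p; cases p') auto
    also have "\<dots> \<longleftrightarrow> [u] \<in> F"
    proof
      assume "[u] \<in> F"
      then show "p = [u]" using p(1) uw(1) f by (metis IntI empty_iff list.set_intros(1))
    qed (use p in simp)
    finally show ?thesis by (simp add: isos_def)
  qed
  have iq: "last q' = w \<longleftrightarrow> w \<in> isos F"
  proof -
    have "last q' = w \<longleftrightarrow> q' = [w]" using hd_eq_last_iff[of q'] q' q f by auto
    also have "\<dots> \<longleftrightarrow> q = [w]" using q' uw by (cases q; cases q') auto
    also have "\<dots> \<longleftrightarrow> [w] \<in> F"
    proof
      assume "[w] \<in> F"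
      then show "q = [w]" using q(1) uw(2) f by (metis IntI empty_iff list.set_intros(1))
    qed (use q in simp)
    finally show ?thesis by (simp add: isos_def)
  qed
  have "ends F' = ends F - ({u, w} - isos F)"
  proof -
    have h: "hd p' \<in> set p" "last q' \<in> set q"
      using p'(2,7) q'(2,7) hd_in_set[of p'] last_in_set[of q'] by auto
    have "ends F = {hd p, last p} \<union> {hd q, last q} \<union> ends G" by (auto simp: FG ends_def)
    then have 1: "ends F = {hd p', u} \<union> {w, last q'} \<union> ends G"
      using p'(1,5) q'(1,5) by simp
    have 2: "ends F' = {hd p', last q'} \<union> ends G"
      using p'(7) q'(7) by (auto simp: F'_def ends_def)
    show ?thesis
      unfolding 1 2 using ip iq h eG uw disj by blast
  qed
  moreover have "isos F' = isos F - {u, w}"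
  proof -
    have "[v] \<noteq> p' @ q'" for v using p'(7) q'(7) by (cases p') auto
    then have 1: "isos F' = isos G" by (auto simp: isos_def F'_def)
    have "v \<in> isos F - {u, w} \<longleftrightarrow> v \<in> isos G" for v
    proof
      assume "v \<in> isos G"
      then have "[v] \<in> G" by (simp add: isos_def)
      then show "v \<in> isos F - {u, w}" using dG[of "[v]"] uw by (auto simp: isos_def FG)
    next
      assume "v \<in> isos F - {u, w}"
      then show "v \<in> isos G" using uw by (auto simp: isos_def FG)
    qed
    then show ?thesis using 1 by blast
  qed
  ultimately have "joins n F u w F'" unfolding joins_def by simp
  then show ?thesis ..
qed

section \<open>Joining ends of high Blue degree\<close>

definition legal :: "nat list set \<Rightarrow> nat set set \<Rightarrow> nat \<Rightarrow> nat \<Rightarrow> bool" where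
  "legal F B u w \<longleftrightarrow> u \<in> ends F \<and> w \<in> ends F \<and> \<not> connected F u w \<and> {u, w} \<notin> B"

lemma legal_neq: "forest n F \<Longrightarrow> legal F B u w \<Longrightarrow> u \<noteq> w"
proof
  assume F: "forest n F" and l: "legal F B u w" and eq: "u = w"
  obtain p where p: "p \<in> F" "u \<in> {hd p, last p}" using l by (auto simp: legal_def ends_def)
  then have "u \<in> set p" using F by (auto simp: forest_def)
  then show False using l eq p by (auto simp: legal_def connected_def)
qed

text \<open>An end is no partner for \<open>u\<close> only if it is \<open>u\<close> itself, the
  other end of its path, or a Blue neighbour.\<close>

lemma card_illegal_le:
  assumes "forest n F" "finite B" "u \<in> ends F"
  shows "card (ends F - {w. legal F B u w}) \<le> 2 + deg (inner B (ends F)) u"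
proof -
  obtain u' where u': "\<forall>w\<in>ends F - {u, u'}. \<not> connected F u w" using mate_exists assms by blast
  define N where "N = {w \<in> ends F. {u, w} \<in> B}"
  have "inj_on (\<lambda>w. {u, w}) N" by (auto simp: inj_on_def doubleton_eq_iff)
  then have "card N = card ((\<lambda>w. {u, w}) ` N)" by (simp add: card_image)
  also have "\<dots> \<le> card {b \<in> inner B (ends F). u \<in> b}"
    using assms by (intro card_mono) (auto simp: N_def inner_def)
  finally have N: "card N \<le> deg (inner B (ends F)) u" by (simp add: deg_def)
  have "ends F - {w. legal F B u w} \<subseteq> {u, u'} \<union> N" using u' assms(3) by (auto simp: legal_def N_def)
  then have "card (ends F - {w. legal F B u w}) \<le> card ({u, u'} \<union> N)"
    using finite_ends[OF assms(1)] by (intro card_mono) (auto simp: N_def)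
  also have "\<dots> \<le> card {u, u'} + card N" by (rule card_Un_le)
  also have "card {u, u'} \<le> 2" by (simp add: card_insert_if)
  finally show ?thesis using N by simp
qed

lemma legal_exists:
  assumes "forest n F" "finite B" "u \<in> ends F" "deg (inner B (ends F)) u + 3 \<le> card (ends F)"
  shows "\<exists>w. legal F B u w"
proof (rule ccontr)
  assume "\<nexists>w. legal F B u w"
  then show False using card_illegal_le[OF assms(1-3)] assms(4) by simp
qed

lemma inner_legal:
  assumes "forest n F" "B \<subseteq> complete_edges n" "legal F B u w"
  shows "card (inner B (ends F)) = card (inner B (ends F - {u, w}))
    + deg (inner B (ends F)) u + deg (inner B (ends F)) w"
  using assms legal_neq[OF assms(1,3)] finite_blue[OF assms(2)]
  by (intro inner_remove) (auto simp: legal_def complete_edges_def)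

lemma sum_deg_inner:
  assumes "forest n F" "B \<subseteq> complete_edges n"
  shows "(\<Sum>v\<in>ends F. deg (inner B (ends F)) v) = 2 * card (inner B (ends F))"
  using assms finite_ends finite_blue[OF assms(2)]
  by (intro sum_deg) (auto simp: inner_def complete_edges_def)

text \<open>Handshake sum over all ends, where the few illegal partners contribute at most the
  maximum degree each. If \<open>card (inner B (ends F))\<close> is large, some legal partner of
  \<open>u\<close> must therefore have large degree.\<close>

lemma sum_deg_legal:
  assumes "forest n F" "B \<subseteq> complete_edges n" "u \<in> ends F"
    and max: "\<And>v. v \<in> ends F \<Longrightarrow> deg (inner B (ends F)) v \<le> deg (inner B (ends F)) u"
  shows "2 * card (inner B (ends F)) \<le> (2 + deg (inner B (ends F)) u) * deg (inner B (ends F)) u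
    + (\<Sum>w | legal F B u w. deg (inner B (ends F)) w)"
proof -
  let ?d = "deg (inner B (ends F))" and ?L = "{w. legal F B u w}"
  have L: "?L \<subseteq> ends F" by (auto simp: legal_def)
  have "2 * card (inner B (ends F)) = (\<Sum>v\<in>ends F. ?d v)" using sum_deg_inner assms by simp
  also have "\<dots> = (\<Sum>v\<in>ends F - ?L. ?d v) + (\<Sum>v\<in>?L. ?d v)"
    using finite_ends[OF assms(1)] L by (rule sum.subset_diff[rotated])
  also have "(\<Sum>v\<in>ends F - ?L. ?d v) \<le> of_nat (card (ends F - ?L)) * ?d u"
    using max by (intro sum_bounded_above) auto
  also have "\<dots> \<le> (2 + ?d u) * ?d u"
    using card_illegal_le[OF assms(1) finite_blue[OF assms(2)] assms(3)]
    by (metis mult_le_mono1 of_nat_id)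
  finally show ?thesis by simp
qed

lemma max_deg_exists:
  assumes "forest n F" "ends F \<noteq> {}"
  obtains u where "u \<in> ends F" "\<And>v. v \<in> ends F \<Longrightarrow> deg (inner B (ends F)) v \<le> deg (inner B (ends F)) u"
proof -
  let ?d = "deg (inner B (ends F))"
  have "Max (?d ` ends F) \<in> ?d ` ends F" using assms finite_ends by (intro Max_in) auto
  then obtain u where "u \<in> ends F" "?d u = Max (?d ` ends F)" by auto
  then show ?thesis using that[of u] assms finite_ends by (metis Max_ge finite_imageI imageI)
qed

text \<open>By averaging the maximum degree is at least two. If it is at least four, any legal
  partner will do, and \<open>d\<close> provides one; otherwise a legal partner of degree at least
  two is found by counting.\<close>

lemma join_drop4:
  assumes F: "forest n F" and iso: "isos F = {}" and B: "B \<subseteq> complete_edges n"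
    and e: "card F + 8 \<le> card (inner B (ends F))"
    and d: "\<And>v. v \<in> ends F \<Longrightarrow> deg (inner B (ends F)) v + 3 \<le> 2 * card F"
  shows "\<exists>u w. legal F B u w \<and> card (inner B (ends F - {u, w})) + 4 \<le> card (inner B (ends F))"
proof -
  let ?d = "deg (inner B (ends F))" and ?e = "card (inner B (ends F))"
  have cE: "card (ends F) = 2 * card F" using card_ends_isos[OF F] iso by simp
  have "ends F \<noteq> {}"
  proof
    assume "ends F = {}"
    then have "inner B (ends F) = {}" using B by (auto simp: inner_def complete_edges_def)
    then show False using e by simp
  qed
  then obtain u where u: "u \<in> ends F" "\<And>v. v \<in> ends F \<Longrightarrow> ?d v \<le> ?d u"
    using max_deg_exists[OF F] by metis
  have "2 * ?e \<le> card (ends F) * ?d u"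
    using sum_deg_inner[OF F B] sum_bounded_above[of "ends F" ?d "?d u"] u by simp
  then have "2 \<le> ?d u" using e cE by (cases "?d u"; cases "?d u - 1") auto
  show ?thesis
  proof (cases "?d u \<ge> 4")
    case True
    obtain w where w: "legal F B u w" using legal_exists[OF F finite_blue[OF B] u(1)] d[OF u(1)] cE by auto
    then show ?thesis using inner_legal[OF F B w] True by (intro exI[of _ u] exI[of _ w]) simp
  next
    case False
    have "\<exists>w. legal F B u w \<and> 2 \<le> ?d w"
    proof (rule ccontr)
      assume "\<not> ?thesis"
      then have "(\<Sum>w | legal F B u w. ?d w) \<le> of_nat (card {w. legal F B u w}) * 1"
        by (intro sum_bounded_above) fastforce
      also have "card {w. legal F B u w} \<le> card (ends F)"
        using finite_ends[OF F] by (intro card_mono) (auto simp: legal_def)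
      finally have "2 * ?e \<le> (2 + ?d u) * ?d u + 2 * card F"
        using sum_deg_legal[OF F B u] cE by simp
      \<comment> \<open>Maximum degree three gives \<open>2 * e \<le> 15 + 2 * k\<close>, which
        contradicts \<open>k + 8 \<le> e\<close>; this is the origin of the
        \<open>8\<close>.\<close>
      moreover have "(2 + ?d u) * ?d u \<le> 5 * 3" using False by (intro mult_mono) auto
      ultimately show False using e by simp
    qed
    then obtain w where w: "legal F B u w" "2 \<le> ?d w" by blast
    then show ?thesis using inner_legal[OF F B w(1)] \<open>2 \<le> ?d u\<close> by (intro exI[of _ u] exI[of _ w]) simp
  qed
qed

lemma join_drop3:
  assumes F: "forest n F" and iso: "isos F = {}" and B: "B \<subseteq> complete_edges n"
    and e: "card F + 1 \<le> card (inner B (ends F))" "card (inner B (ends F)) + 3 \<le> 2 * card F"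
  shows "\<exists>u w. legal F B u w \<and> card (inner B (ends F - {u, w})) + 3 \<le> card (inner B (ends F))"
proof -
  let ?d = "deg (inner B (ends F))" and ?e = "card (inner B (ends F))"
  have cE: "card (ends F) = 2 * card F" using card_ends_isos[OF F] iso by simp
  have fin: "finite (inner B (ends F))" using finite_blue[OF B] by (simp add: inner_def)
  have "ends F \<noteq> {}" using cE e by auto
  then obtain u where u: "u \<in> ends F" "\<And>v. v \<in> ends F \<Longrightarrow> ?d v \<le> ?d u"
    using max_deg_exists[OF F] by metis
  have "2 * ?e \<le> card (ends F) * ?d u"
    using sum_deg_inner[OF F B] sum_bounded_above[of "ends F" ?d "?d u"] u by simp
  then have "2 \<le> ?d u" using e cE by (cases "?d u"; cases "?d u - 1") auto
  show ?thesis
  proof (cases "?d u \<ge> 3")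
    case True
    have "?d u + 3 \<le> card (ends F)" using deg_le_card[OF fin, of u] e cE by simp
    then obtain w where w: "legal F B u w" using legal_exists[OF F finite_blue[OF B] u(1)] by auto
    then show ?thesis using inner_legal[OF F B w] True by (intro exI[of _ u] exI[of _ w]) simp
  next
    case False
    then have 2: "?d u = 2" using \<open>2 \<le> ?d u\<close> by simp
    have "\<exists>w. legal F B u w \<and> 1 \<le> ?d w"
    proof (rule ccontr)
      assume "\<not> ?thesis"
      then have "(\<Sum>w | legal F B u w. ?d w) = 0" by (intro sum.neutral) (auto simp: not_less_eq_eq)
      \<comment> \<open>The counting bound is \<open>2 * e \<le> 4 * 2\<close>, whereas the two
        hypotheses on \<open>e\<close> give \<open>4 \<le> k\<close> and so
        \<open>5 \<le> e\<close>.\<close>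
      then show False using sum_deg_legal[OF F B u] e 2 by simp
    qed
    then obtain w where w: "legal F B u w" "1 \<le> ?d w" by blast
    then show ?thesis using inner_legal[OF F B w(1)] 2 by (intro exI[of _ u] exI[of _ w]) simp
  qed
qed

text \<open>The subtraction is truncated: for \<open>e \<le> 1\<close> the claim is that no Blue
  edge between ends survives. For \<open>e \<ge> 2\<close> and maximum degree one, counting yields a
  legal partner of degree one.\<close>

lemma join_drop2:
  assumes F: "forest n F" and iso: "isos F = {}" and B: "B \<subseteq> complete_edges n"
    and e: "card (inner B (ends F)) + 3 \<le> 2 * card F"
  shows "\<exists>u w. legal F B u w \<and> card (inner B (ends F - {u, w})) \<le> card (inner B (ends F)) - 2"
proof -
  let ?d = "deg (inner B (ends F))" and ?e = "card (inner B (ends F))"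
  have cE: "card (ends F) = 2 * card F" using card_ends_isos[OF F] iso by simp
  have fin: "finite (inner B (ends F))" using finite_blue[OF B] by (simp add: inner_def)
  have "ends F \<noteq> {}" using cE e by auto
  then obtain u where u: "u \<in> ends F" "\<And>v. v \<in> ends F \<Longrightarrow> ?d v \<le> ?d u"
    using max_deg_exists[OF F] by metis
  have "2 * ?e \<le> card (ends F) * ?d u"
    using sum_deg_inner[OF F B] sum_bounded_above[of "ends F" ?d "?d u"] u by simp
  then have 0: "?e = 0" if "?d u = 0" using that by simp
  have "?d u + 3 \<le> card (ends F)" using deg_le_card[OF fin, of u] e cE by simp
  then obtain w where w: "legal F B u w" using legal_exists[OF F finite_blue[OF B] u(1)] by auto
  show ?thesis
  proof (cases "?d u \<ge> 2 \<or> ?e \<le> 1")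
    case True
    then have "card (inner B (ends F - {u, w})) \<le> ?e - 2"
      using inner_legal[OF F B w] 0 by (cases "?d u = 0") auto
    then show ?thesis using w by blast
  next
    case False
    then have 2: "?d u = 1" using 0 by (cases "?d u") auto
    have "\<exists>w. legal F B u w \<and> 1 \<le> ?d w"
    proof (rule ccontr)
      assume "\<not> ?thesis"
      then have "(\<Sum>w | legal F B u w. ?d w) = 0" by (intro sum.neutral) (auto simp: not_less_eq_eq)
      then show False using sum_deg_legal[OF F B u] False 2 by simp
    qed
    then obtain w where w: "legal F B u w" "1 \<le> ?d w" by blast
    then show ?thesis using inner_legal[OF F B w(1)] 2 by (intro exI[of _ u] exI[of _ w]) simp
  qed
qed

section \<open>Closing the Hamilton cycle\<close>

text \<open>Ensures that the board is not exhausted within Red's \<open>2 * n + 2\<close> steps, so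
  no draw can intervene.\<close>

lemma card_complete_edges_gt:
  assumes "n \<ge> 10" shows "card (complete_edges n) > 2 * n + 2"
proof -
  have "2 * (2 * n + 3) \<le> 10 * (n - 1)" using assms by presburger
  also have "\<dots> \<le> n * (n - 1)" using assms by (intro mult_right_mono) auto
  finally have "2 * (2 * n + 3) \<le> n * (n - 1)" .
  then have "2 * (2 * n + 3) div 2 \<le> n * (n - 1) div 2" by (rule div_le_mono)
  then show ?thesis by (simp add: card_complete_edges choose_two)
qed

lemma psubset_complete_edges:
  assumes "n \<ge> 10" "R \<union> B \<subseteq> complete_edges n" "card R + card B \<le> 2 * n + 2"
  shows "R \<union> B \<subset> complete_edges n"
proof -
  have "card (R \<union> B) \<le> 2 * n + 2" using assms(3) card_Un_le[of R B] by linarith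
  then show ?thesis using assms(1,2) card_complete_edges_gt[of n] by auto
qed

lemma forces_red:
  assumes "\<not> completed W B" "red_turn l" "e \<in> X" "e \<notin> R" "e \<notin> B" "forces X W m (Suc l) (insert e R) B"
  shows "forces X W (Suc m) l R B"
  using assms by auto

lemma forces_blue:
  assumes "\<not> completed W B" "\<not> red_turn l" "R \<union> B \<subset> X"
    "\<And>e. e \<in> X \<Longrightarrow> e \<notin> R \<Longrightarrow> e \<notin> B \<Longrightarrow> forces X W m (Suc l) R (insert e B)"
  shows "forces X W (Suc m) l R B"
  using assms by auto

lemma forces_finish1:
  assumes "\<not> completed W B" "red_turn l" "H \<in> W" "H \<subseteq> X" "finite H" "H \<inter> B = {}" "card (H - R) \<le> 1"
  shows "forces X W (Suc m) l R B"
proof (cases "H \<subseteq> R")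
  case True
  then have "completed W R" using assms(3) by (auto simp: completed_def)
  then show ?thesis by (rule forces_completed)
next
  case False
  then obtain e where e: "e \<in> H" "e \<notin> R" by blast
  have "card (H - R) = 1" using assms(5,7) False by (simp add: card_gt_0_iff le_antisym Suc_leI)
  then obtain x where "H - R = {x}" by (rule card_1_singletonE)
  then have "H - R = {e}" using e by (metis DiffI singletonD)
  then have "completed W (insert e R)" using assms(3) unfolding completed_def by blast
  then have "forces X W m (Suc l) (insert e R) B" by (rule forces_completed)
  then show ?thesis using assms e by (intro forces_red[of W B l e]) auto
qed

lemma forces_finish2:
  assumes "\<not> completed W B" "red_turn l" "red_turn (Suc l)" "H \<in> W" "H \<subseteq> X" "finite H" "H \<inter> B = {}"
    and card: "card (H - R) \<le> 2"
  shows "forces X W (Suc (Suc m)) l R B"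
proof (cases "H \<subseteq> R")
  case True
  then have "completed W R" using assms(4) by (auto simp: completed_def)
  then show ?thesis by (rule forces_completed)
next
  case False
  then obtain e where e: "e \<in> H" "e \<notin> R" by blast
  have "H - insert e R = (H - R) - {e}" by auto
  then have "card (H - insert e R) \<le> 1" using e assms(6) card by (simp add: card_Diff_singleton)
  then have "forces X W (Suc m) (Suc l) (insert e R) B" using assms by (intro forces_finish1) auto
  then show ?thesis using assms e by (intro forces_red[of W B l e]) auto
qed

lemma hamilton_cycleI:
  assumes "distinct v" "set v = {..<n}" "n \<ge> 3"
  shows "cycle_edges v \<in> hamilton_cycles n"
  unfolding hamilton_cycles_def using assms distinct_card[of v] by auto

lemma hamilton_cycle_subset: "H \<in> hamilton_cycles n \<Longrightarrow> H \<subseteq> complete_edges n"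
proof (elim hamilton_cycleE, rule subsetI)
  fix vs e assume v: "H = cycle_edges vs" "distinct vs" "set vs = {..<n}" "length vs = n" "n \<ge> 3" "e \<in> H"
  then obtain i where i: "i < n" "e = {vs ! i, vs ! (Suc i mod n)}" by (auto simp: cycle_edges_def)
  have l: "Suc i mod n < n" using i by (intro mod_less_divisor) auto
  have "i \<noteq> Suc i mod n" using v(5) i(1) by (cases "Suc i = n") auto
  then have "vs ! i \<noteq> vs ! (Suc i mod n)" using v i l by (simp add: nth_eq_iff_index_eq)
  then show "e \<in> complete_edges n"
    using v i l nth_mem[of i vs] nth_mem[of "Suc i mod n" vs] by (simp add: complete_edges_def)
qed

lemma cycle_edges_append:
  assumes "us \<noteq> []" "ws \<noteq> []"
  shows "cycle_edges (us @ ws) = {{last us, hd ws}, {last ws, hd us}} \<union> pedges us \<union> pedges ws"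
  using assms by (auto simp: cycle_edges_eq pedges_append)

lemma card_nth_nbrs_le:
  assumes "finite B" "distinct v" "\<And>i. i \<in> I \<Longrightarrow> f i < length v \<and> {a, v ! f i} \<in> B" "inj_on f I"
  shows "card I \<le> deg B a"
proof -
  have "inj_on (\<lambda>i. {a, v ! f i}) I"
    using assms by (auto simp: inj_on_def doubleton_eq_iff nth_eq_iff_index_eq)
  then have "card I = card ((\<lambda>i. {a, v ! f i}) ` I)" by (simp add: card_image)
  also have "\<dots> \<le> deg B a" unfolding deg_def using assms by (intro card_mono) auto
  finally show ?thesis .
qed

text \<open>A Hamilton path is closed by a rotation: drop the edge between its \<open>i\<close>-th vertex and the
  next one, and join these two vertices to the last and to the first vertex, respectively.\<close>

lemma rotation_exists:
  assumes v: "distinct v" "set v = {..<n}" "n \<ge> 5" and B: "finite B" "pedges v \<inter> B = {}"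
    and d: "deg B (hd v) + deg B (last v) + 4 \<le> n"
  shows "\<exists>H\<in>hamilton_cycles n. H \<inter> B = {} \<and> card (H - pedges v) \<le> 2"
proof -
  have len: "length v = n" using v distinct_card by fastforce
  have vne: "v \<noteq> []" using len v(3) by fastforce
  \<comment> \<open>For these \<open>n - 3\<close> indices neither new edge is an edge of the path.
    Every edge of \<open>B\<close> at one of the two ends rules out at most one index from its side,
    and the degrees sum to at most \<open>n - 4\<close>.\<close>
  define I where "I = {1..n - 3}"
  have "\<exists>i\<in>I. {hd v, v ! Suc i} \<notin> B \<and> {last v, v ! i} \<notin> B"
  proof (rule ccontr)
    assume "\<not> ?thesis"
    then have I: "I = {i \<in> I. {hd v, v ! Suc i} \<in> B} \<union> {i \<in> I. {last v, v ! i} \<in> B}" (is "_ = ?A \<union> ?C") by auto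
    have "card ?A \<le> deg B (hd v)"
      using B v len by (intro card_nth_nbrs_le[where f = Suc]) (auto simp: I_def)
    moreover have "card ?C \<le> deg B (last v)"
      using B v len by (intro card_nth_nbrs_le[where f = id]) (auto simp: I_def)
    moreover have "card I \<le> card ?A + card ?C" using card_Un_le[of ?A ?C] I by simp
    moreover have "card I = n - 3" by (simp add: I_def)
    ultimately show False using d v(3) by linarith
  qed
  then obtain i where i: "1 \<le> i" "i \<le> n - 3" "{hd v, v ! Suc i} \<notin> B" "{last v, v ! i} \<notin> B"
    by (auto simp: I_def)
  define us ws where "us = take (Suc i) v" and "ws = drop (Suc i) v"
  have v_eq: "v = us @ ws" by (simp add: us_def ws_def)
  have ne: "us \<noteq> []" "ws \<noteq> []" using i v(3) len vne by (auto simp: us_def ws_def)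
  have hds: "hd us = hd v" "last us = v ! i" "hd ws = v ! Suc i" "last ws = last v"
    using i v(3) len vne by (auto simp: us_def ws_def hd_drop_conv_nth take_Suc_conv_app_nth)
  have pv: "pedges us \<union> pedges ws \<subseteq> pedges v" using pedges_append[OF ne] v_eq by auto
  let ?H = "cycle_edges (us @ rev ws)"
  have H: "?H = {{last v, v ! i}, {hd v, v ! Suc i}} \<union> pedges us \<union> pedges ws"
    using cycle_edges_append[of us "rev ws"] ne hds by (simp add: hd_rev last_rev insert_commute)
  have "?H \<in> hamilton_cycles n"
    using v v_eq by (intro hamilton_cycleI) (metis distinct_append distinct_rev set_rev, metis set_append set_rev, simp)
  moreover have "?H \<inter> B = {}" using H i pv B by auto
  moreover have "card (?H - pedges v) \<le> card {{last v, v ! i}, {hd v, v ! Suc i}}"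
    using H pv by (intro card_mono) auto
  then have "card (?H - pedges v) \<le> 2" by (simp add: card_insert_if split: if_splits)
  ultimately show ?thesis by blast
qed

text \<open>Only the edge \<open>{a, c}\<close> can be counted twice. Applied to Blue's late edges,
  this bounds the damage they do to both ends of Red's path together.\<close>

lemma deg_add_le:
  assumes "finite D" "a \<noteq> c" "\<And>b. b \<in> D \<Longrightarrow> card b = 2"
  shows "deg D a + deg D c \<le> card D + 1"
proof -
  let ?A = "{b \<in> D. a \<in> b}" and ?C = "{b \<in> D. c \<in> b}"
  have "?A \<inter> ?C \<subseteq> {{a, c}}"
  proof
    fix b assume b: "b \<in> ?A \<inter> ?C"
    then obtain x y where "b = {x, y}" using assms(3)[of b] by (auto simp: card_2_iff)
    then show "b \<in> {{a, c}}" using b assms(2) by auto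
  qed
  then have "card (?A \<inter> ?C) \<le> card {{a, c}}" by (intro card_mono) auto
  moreover have "card (?A \<union> ?C) \<le> card D" using assms by (intro card_mono) auto
  moreover have "card ?A + card ?C = card (?A \<union> ?C) + card (?A \<inter> ?C)"
    using assms by (intro card_Un_Int) auto
  ultimately show ?thesis by (simp add: deg_def)
qed

text \<open>Red joins the paths to a Hamilton path and claims one spare edge; Blue then reaches
  \<open>n\<close> edges but, having wasted one, no Hamilton cycle; Red closes by a rotation. These
  are the six steps.\<close>

lemma forces_from_two_paths:
  assumes n: "n \<ge> 10" and l: "l mod 4 = 0" and R: "R \<subseteq> complete_edges n" "card R \<le> n"
    and B: "B \<subseteq> complete_edges n" "card B + 2 = n" "R \<inter> B = {}" and was: "wasted n B"
    and us: "us \<noteq> []" "ws \<noteq> []" "distinct (us @ ws)" "set (us @ ws) = {..<n}"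
      "pedges us \<union> pedges ws \<subseteq> R"
    and e: "{last us, hd ws} \<notin> R" "{last us, hd ws} \<notin> B"
    and low: "A \<subseteq> B" "deg A (hd us) \<le> d" "deg A (last ws) \<le> d" "2 * d + 10 \<le> card A"
  shows "forces (complete_edges n) (hamilton_cycles n) 6 l R B"
proof -
  let ?X = "complete_edges n" and ?W = "hamilton_cycles n"
  have fin: "finite B" "finite R" using B R finite_blue by auto
  have turns: "red_turn l" "red_turn (Suc l)" "\<not> red_turn (l + 2)" "\<not> red_turn (l + 3)"
    "red_turn (l + 4)" "red_turn (Suc (l + 4))" using l unfolding red_turn_def by presburger+
  have nb: "\<not> completed ?W C" if "B \<subseteq> C" "card C \<le> n" "finite C" for C
    using that was wasted_mono wasted_not_completed by blast
  let ?v = "us @ ws" and ?e = "{last us, hd ws}"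
  have pv: "pedges ?v = insert ?e (pedges us \<union> pedges ws)" using us pedges_append by blast
  have ends: "last us \<in> set us" "hd ws \<in> set ws" using us by auto
  have "?e \<in> ?X" using ends us(3,4) by (auto simp: complete_edges_def card_insert_if)
  \<comment> \<open>The spare edge may be any free edge.\<close>
  obtain x where x: "x \<in> ?X" "x \<notin> insert ?e R" "x \<notin> B"
  proof -
    have "insert ?e R \<union> B \<subset> ?X"
      using R B n \<open>?e \<in> ?X\<close> fin by (intro psubset_complete_edges) (auto simp: card_insert_if)
    then show ?thesis using that by blast
  qed
  define S where "S = insert x (insert ?e R)"
  have S: "S \<subseteq> ?X" "card S \<le> n + 2" "S \<inter> B = {}" "pedges ?v \<subseteq> S"
    using R B x e us pv fin \<open>?e \<in> ?X\<close> by (auto simp: S_def card_insert_if)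
  have fin_win: "forces ?X ?W 2 (l + 4) S (insert g (insert f B))"
    if f: "f \<in> ?X" "f \<notin> S" "f \<notin> B" and g: "g \<in> ?X" "g \<notin> S" "g \<notin> insert f B" for f g
  proof -
    let ?C = "insert g (insert f B)"
    have C: "card ?C = n" "finite ?C" "?C \<subseteq> ?X" using f g fin B by auto
    have "hd us \<noteq> last ws" using us by (metis disjoint_iff distinct_append hd_in_set last_in_set)
    then have "deg (?C - A) (hd us) + deg (?C - A) (last ws) \<le> card (?C - A) + 1"
      using C by (intro deg_add_le) (auto simp: complete_edges_def)
    moreover have "deg ?C v = deg A v + deg (?C - A) v" for v
      using C low(1) by (intro deg_diff) auto
    moreover have "card (?C - A) = n - card A" using C low(1) fin
      by (subst card_Diff_subset) (auto intro: finite_subset)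
    moreover have "card A \<le> n" using C low(1) card_mono[of ?C A] by auto
    \<comment> \<open>The sum is at most \<open>2 * d + (n - card A) + 1\<close>, and
      \<open>2 * d + 10 \<le> card A\<close>.\<close>
    ultimately have "deg ?C (hd us) + deg ?C (last ws) + 4 \<le> n"
      using low by (simp del: insert_iff)
    moreover have "pedges ?v \<inter> ?C = {}" using S f g by auto
    moreover have "hd ?v = hd us" "last ?v = last ws" using us by auto
    ultimately have "\<exists>H\<in>?W. H \<inter> ?C = {} \<and> card (H - pedges ?v) \<le> 2"
      using us C n by (intro rotation_exists) simp_all
    then obtain H where H: "H \<in> ?W" "H \<inter> ?C = {}" "card (H - pedges ?v) \<le> 2" by blast
    have "card (H - S) \<le> card (H - pedges ?v)"
      using S(4) finite_hamilton_cycle[OF H(1)] by (intro card_mono) auto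
    then have "forces ?X ?W (Suc (Suc 0)) (l + 4) S ?C"
      using H C turns nb[of ?C] hamilton_cycle_subset[OF H(1)] finite_hamilton_cycle[OF H(1)]
      by (intro forces_finish2[of _ _ _ H]) auto
    then show ?thesis by (simp add: numeral_2_eq_2)
  qed
  have "forces ?X ?W (Suc (Suc (Suc (Suc 2)))) l R B"
  proof (rule forces_red[of _ _ _ ?e])
    show "forces ?X ?W (Suc (Suc (Suc 2))) (Suc l) (insert ?e R) B"
    proof (rule forces_red[of _ _ _ x])
      have "forces ?X ?W (Suc (Suc 2)) (l + 2) S B"
      proof (rule forces_blue)
        fix f assume f: "f \<in> ?X" "f \<notin> S" "f \<notin> B"
        have "forces ?X ?W (Suc 2) (l + 3) S (insert f B)"
        proof (rule forces_blue)
          fix g assume "g \<in> ?X" "g \<notin> S" "g \<notin> insert f B"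
          then show "forces ?X ?W 2 (Suc (l + 3)) S (insert g (insert f B))"
            using fin_win[OF f] by (simp add: numeral_eq_Suc)
        next
          show "S \<union> insert f B \<subset> ?X" using S B f n fin
            by (intro psubset_complete_edges) auto
        qed (use turns nb[of "insert f B"] f B fin in auto)
        then show "forces ?X ?W (Suc 2) (Suc (l + 2)) S (insert f B)" by (simp add: numeral_eq_Suc)
      next
        show "S \<union> B \<subset> ?X" using S B n by (intro psubset_complete_edges) auto
      qed (use turns nb[of B] B fin in auto)
      then show "forces ?X ?W (Suc (Suc 2)) (Suc (Suc l)) (insert x (insert ?e R)) B"
        by (simp add: S_def)
    qed (use x turns nb[of B] B fin in auto)
  qed (use e \<open>?e \<in> ?X\<close> turns nb[of B] B fin in auto)
  then show ?thesis by (simp add: numeral_eq_Suc)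
qed

section \<open>Positions in which Red holds a linear forest\<close>

text \<open>The number of edges by which Red is ahead of Blue after \<open>l\<close> steps.\<close>

definition lead :: "nat \<Rightarrow> nat" where
  "lead l = (if l mod 4 = 0 then 0 else if l mod 4 = 2 then 2 else 1)"

lemma lead_Suc_red: "red_turn l \<Longrightarrow> lead (Suc l) = Suc (lead l)"
  unfolding red_turn_def lead_def mod_Suc by (cases "l mod 4 = 0"; cases "l mod 4 = 1") auto

lemma lead_Suc_blue: "\<not> red_turn l \<Longrightarrow> lead l = Suc (lead (Suc l))"
proof -
  assume "\<not> red_turn l"
  then have "l mod 4 = 2 \<or> l mod 4 = 3" unfolding red_turn_def by presburger
  then show ?thesis by (auto simp: lead_def mod_Suc)
qed

text \<open>Every Red edge so far is a join, so \<open>F\<close> determines Red's position. The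
  three equations count the edges of a linear forest, compare them with Blue's by means of
  \<open>lead\<close>, and identify the step.\<close>

definition state :: "nat \<Rightarrow> nat \<Rightarrow> nat list set \<Rightarrow> nat set set \<Rightarrow> bool" where
  "state n l F B \<longleftrightarrow> forest n F \<and> B \<subseteq> complete_edges n \<and> B \<inter> red F = {} \<and>
     card (red F) + card F = n \<and> card F + card B + lead l = n \<and> l = card (red F) + card B"

definition win :: "nat \<Rightarrow> nat \<Rightarrow> nat list set \<Rightarrow> nat set set \<Rightarrow> bool" where
  "win n l F B \<longleftrightarrow> forces (complete_edges n) (hamilton_cycles n) (2 * n + 2 - l) l (red F) B"

lemma pedges_subset_complete:
  "distinct p \<Longrightarrow> set p \<subseteq> {..<n} \<Longrightarrow> pedges p \<subseteq> complete_edges n"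
  by (induction p rule: pedges.induct) (auto simp: complete_edges_def)

lemma red_subset: "forest n F \<Longrightarrow> red F \<subseteq> complete_edges n"
  unfolding red_def forest_def by (intro UN_least pedges_subset_complete) auto

lemma card_forest_pos: "forest n F \<Longrightarrow> n > 0 \<Longrightarrow> card F > 0"
  unfolding forest_def by (auto simp: card_gt_0_iff)

lemma state_not_completed:
  assumes "state n l F B" "n > 0"
  shows "\<not> completed (hamilton_cycles n) B"
  using assms finite_blue[of B n] card_forest_pos[of n F]
  by (intro not_completed_if_card_less) (auto simp: state_def)

lemma red_step:
  assumes s: "state n l F B" and n: "n > 0" and t: "red_turn l" and uw: "legal F B u w"
    and win: "\<And>F'. joins n F u w F' \<Longrightarrow> state n (Suc l) F' B \<Longrightarrow> win n (Suc l) F' B"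
  shows "win n l F B"
proof -
  note st = s[unfolded state_def]
  obtain F' where j: "joins n F u w F'" using join_exists st uw unfolding legal_def by blast
  note jn = j[unfolded joins_def]
  have u: "{u, w} \<notin> red F" "{u, w} \<notin> B" using edge_not_red[of F u w] uw by (auto simp: legal_def)
  have "u < n" "w < n" "u \<noteq> w" using uw st ends_subset[of n F] legal_neq[of n F B u w] by (auto simp: legal_def)
  then have uX: "{u, w} \<in> complete_edges n" by (auto simp: complete_edges_def)
  have c: "card (red F') = Suc (card (red F))" using u jn finite_red[of n F] st by simp
  have "state n (Suc l) F' B"
    unfolding state_def using jn st c u lead_Suc_red[OF t] by auto
  then have "win n (Suc l) F' B" using win j by blast
  moreover have "2 * n + 2 - l = Suc (2 * n + 2 - Suc l)" using st by auto
  ultimately show ?thesis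
    using forces_red[of "hamilton_cycles n" B l "{u, w}" "complete_edges n" "red F"] u uX t jn
      state_not_completed[OF s n] unfolding win_def by simp
qed

lemma blue_step:
  assumes s: "state n l F B" and n: "n \<ge> 10" and t: "\<not> red_turn l"
    and win: "\<And>f. f \<in> complete_edges n \<Longrightarrow> f \<notin> B \<Longrightarrow> state n (Suc l) F (insert f B) \<Longrightarrow>
      win n (Suc l) F (insert f B)"
  shows "win n l F B"
proof -
  note st = s[unfolded state_def]
  have m: "2 * n + 2 - l = Suc (2 * n + 2 - Suc l)" using st by auto
  show ?thesis
    unfolding win_def m
  proof (rule forces_blue)
    show "\<not> completed (hamilton_cycles n) B" using state_not_completed[OF s] n by simp
    show "red F \<union> B \<subset> complete_edges n"
      using st red_subset[of n F] n by (intro psubset_complete_edges) auto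
    fix f assume f: "f \<in> complete_edges n" "f \<notin> red F" "f \<notin> B"
    then have "state n (Suc l) F (insert f B)"
      unfolding state_def using st lead_Suc_blue[OF t] finite_blue[of B n] by auto
    then show "forces (complete_edges n) (hamilton_cycles n) (2 * n + 2 - Suc l) (Suc l) (red F) (insert f B)"
      using win f unfolding win_def by blast
  qed (rule t)
qed

text \<open>\<open>I\<close> is the invariant of a phase and \<open>J\<close> its exit condition,
  which may become true after any step. That \<open>J\<close> is eventually reached needs no
  argument: \<open>state\<close> implies \<open>l \<le> 2 * n\<close>, so \<open>I\<close> cannot be
  kept up forever.\<close>

lemma phase:
  assumes n: "n \<ge> 10"
    and J: "\<And>l F B. state n l F B \<Longrightarrow> J l F B \<Longrightarrow> win n l F B"
    and red: "\<And>l F B. state n l F B \<Longrightarrow> I l F B \<Longrightarrow> red_turn l \<Longrightarrow> J l F B \<or>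
      (\<exists>u w. legal F B u w \<and> (\<forall>F'. joins n F u w F' \<longrightarrow> I (Suc l) F' B \<or> J (Suc l) F' B))"
    and blue: "\<And>l F B. state n l F B \<Longrightarrow> I l F B \<Longrightarrow> \<not> red_turn l \<Longrightarrow> J l F B \<or>
      (\<forall>f\<in>complete_edges n - B. I (Suc l) F (insert f B) \<or> J (Suc l) F (insert f B))"
  shows "state n l F B \<Longrightarrow> I l F B \<Longrightarrow> win n l F B"
proof (induction "2 * n - l" arbitrary: l F B rule: less_induct)
  case less
  note s = less.prems(1)
  have IH: "win n (Suc l) F' B'" if "state n (Suc l) F' B'" "I (Suc l) F' B' \<or> J (Suc l) F' B'" for F' B'
  proof -
    have "Suc l \<le> 2 * n" using that(1) unfolding state_def by linarith
    then show ?thesis using less.hyps that J by auto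
  qed
  show ?case
  proof (cases "J l F B")
    case True
    then show ?thesis using J s by blast
  next
    case False
    show ?thesis
    proof (cases "red_turn l")
      case True
      then obtain u w where uw: "legal F B u w"
        "\<And>F'. joins n F u w F' \<Longrightarrow> I (Suc l) F' B \<or> J (Suc l) F' B"
        using red[OF less.prems True] False by blast
      then show ?thesis using IH n by (intro red_step[OF s _ True uw(1)]) auto
    next
      case t: False
      then show ?thesis using blue[OF less.prems t] False IH by (intro blue_step[OF s n t]) auto
    qed
  qed
qed

section \<open>The endgame with two paths\<close>

text \<open>\<open>A\<close> is a snapshot of Blue's edges. As ends only disappear, the bound
  \<open>d\<close> survives all later steps; the last inequality leaves enough room for the rotation
  once Blue has \<open>n\<close> edges.\<close>

definition bounded_part :: "nat set set \<Rightarrow> nat list set \<Rightarrow> nat set set \<Rightarrow> nat \<Rightarrow> bool" where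
  "bounded_part A F B d \<longleftrightarrow> A \<subseteq> B \<and> (\<forall>v\<in>ends F. deg A v \<le> d) \<and> 2 * d + 10 \<le> card A"

definition spoiled :: "nat \<Rightarrow> nat list set \<Rightarrow> nat set set \<Rightarrow> bool" where
  "spoiled n F B \<longleftrightarrow> wasted n B \<or> (\<forall>v\<in>ends F. deg B v \<ge> 1)"

text \<open>Paths with ends \<open>a\<close>, \<open>b\<close> and \<open>c\<close>,
  \<open>d\<close> can be closed by the first or by the second pair of edges. Blocking edges
  \<open>x\<close> and \<open>y\<close>, one from each pair, always share an end, and the other edge
  of the pair of \<open>x\<close> stays open for a Hamilton path.\<close>

lemma closing_pairs:
  assumes d: "a \<noteq> b" "c \<noteq> d" "a \<noteq> c" "a \<noteq> d" "b \<noteq> c" "b \<noteq> d"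
    and xy: "x \<in> {{b, c}, {d, a}}" "y \<in> {{b, d}, {c, a}}"
  shows "x \<noteq> y" "\<exists>v\<in>{a, b, c, d}. v \<in> x \<and> v \<in> y"
    "x = {b, c} \<Longrightarrow> {d, a} \<notin> {x, y}" "x \<noteq> {b, c} \<Longrightarrow> {b, c} \<notin> {x, y}"
proof -
  note n = d d[symmetric]
  consider "x = {b, c}" "y = {b, d}" | "x = {b, c}" "y = {c, a}" | "x = {d, a}" "y = {b, d}"
    | "x = {d, a}" "y = {c, a}" using xy by blast
  note c = this
  show "x \<noteq> y" by (rule c; simp add: doubleton_eq_iff n)
  show "\<exists>v\<in>{a, b, c, d}. v \<in> x \<and> v \<in> y" by (rule c; simp)
  show "x = {b, c} \<Longrightarrow> {d, a} \<notin> {x, y}" by (rule c; simp add: doubleton_eq_iff n)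
  show "x \<noteq> {b, c} \<Longrightarrow> {b, c} \<notin> {x, y}" by (rule c; simp add: doubleton_eq_iff n)
qed

text \<open>If Blue blocks both ways of closing Red's two paths to a Hamilton cycle, then his two new edges
  meet in an end that already had positive Blue degree, and so he has wasted an edge.\<close>

lemma endgame:
  assumes n: "n \<ge> 10" and s: "state n l F B" and l: "l mod 4 = 2" and F2: "card F = 2"
    and iso: "isos F = {}" and inner: "inner B (ends F) = {}" and sp: "spoiled n F B"
    and bd: "bounded_part A F B d"
  shows "win n l F B"
proof -
  let ?X = "complete_edges n" and ?W = "hamilton_cycles n" and ?R = "red F"
  note st = s[unfolded state_def]
  have lead: "lead l = 2" using l by (simp add: lead_def)
  have cR: "card ?R + 2 = n" and cB: "card B + 4 = n" and m: "2 * n + 2 - l = 8"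
    using st F2 lead by linarith+
  have fin: "finite B" "finite ?R" using st finite_blue finite_red by blast+
  have RX: "?R \<subseteq> ?X" using st red_subset by blast
  obtain p q where pq: "F = {p, q}" "p \<noteq> q" using F2 by (auto simp: card_2_iff)
  have f: "forest n F" using st by blast
  have ne: "p \<noteq> []" "q \<noteq> []" "distinct p" "distinct q" "set p \<union> set q = {..<n}" "set p \<inter> set q = {}"
    using f pq(2) unfolding forest_def pq(1) by auto
  have R: "?R = pedges p \<union> pedges q" by (auto simp: red_def pq)
  have E: "ends F = {hd p, last p, hd q, last q}" by (auto simp: ends_def pq)
  have len: "hd p \<noteq> last p" "hd q \<noteq> last q"
  proof -
    have "[v] \<notin> F" for v using iso by (auto simp: isos_def)
    then show "hd p \<noteq> last p" "hd q \<noteq> last q" using pq ne hd_eq_last_iff by (metis insertCI)+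
  qed
  have cross: "hd p \<noteq> hd q" "hd p \<noteq> last q" "last p \<noteq> hd q" "last p \<noteq> last q"
    using ne(1,2,6) by (metis disjoint_iff hd_in_set last_in_set)+
  have nc: "\<not> connected F x y" if "x \<in> set p" "y \<in> set q" for x y
    using that ne(6) by (auto simp: connected_def pq)
  have mem: "hd p \<in> set p" "last p \<in> set p" "hd q \<in> set q" "last q \<in> set q" using ne by auto
  have crossR: "{x, y} \<notin> ?R" if "x \<in> set p" "y \<in> set q" for x y
    using that by (intro edge_not_red nc)
  have crossB: "{x, y} \<notin> B" if "x \<in> ends F" "y \<in> ends F" for x y
    using inner that by (auto simp: inner_def)
  have turns: "\<not> red_turn l" "\<not> red_turn (Suc l)" "red_turn (Suc (Suc l))" "red_turn (Suc (Suc (Suc l)))"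
    using l unfolding red_turn_def by presburger+
  have l4: "Suc (Suc l) mod 4 = 0" using l by presburger
  have main: "forces ?X ?W 6 (Suc (Suc l)) ?R (insert g (insert f B))"
    if fg: "f \<in> ?X" "f \<notin> ?R" "f \<notin> B" "g \<in> ?X" "g \<notin> ?R" "g \<notin> insert f B" for f g
  proof -
    let ?C = "insert g (insert f B)"
    have C: "?C \<subseteq> ?X" "finite ?C" "card ?C + 2 = n" "?R \<inter> ?C = {}" using fg fin cB st by auto
    have ncC: "\<not> completed ?W ?C" using C by (intro not_completed_if_card_less) auto
    have now: "forces ?X ?W 6 (Suc (Suc l)) ?R ?C" if H: "H \<in> ?W" "H = {a, b} \<union> ?R" "a \<notin> ?C" "b \<notin> ?C" for H a b
    proof -
      have "H \<inter> ?C = {}" using H C(4) by auto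
      moreover have "card (H - ?R) \<le> card {a, b}" using H by (intro card_mono) auto
      then have "card (H - ?R) \<le> 2" by (simp add: card_insert_if split: if_splits)
      ultimately have "forces ?X ?W (Suc (Suc 4)) (Suc (Suc l)) ?R ?C"
        using H turns ncC hamilton_cycle_subset[OF H(1)] finite_hamilton_cycle[OF H(1)]
        by (intro forces_finish2[of _ _ _ H]) auto
      then show ?thesis by (simp add: numeral_eq_Suc)
    qed
    have H1: "cycle_edges (p @ q) \<in> ?W" "cycle_edges (p @ rev q) \<in> ?W"
      using ne n by (intro hamilton_cycleI; simp)+
    have H2: "cycle_edges (p @ q) = {{last p, hd q}, {last q, hd p}} \<union> ?R"
      "cycle_edges (p @ rev q) = {{last p, last q}, {hd q, hd p}} \<union> ?R"
      using ne cycle_edges_append[of p q] cycle_edges_append[of p "rev q"] R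
      by (auto simp: hd_rev last_rev)
    show ?thesis
    proof (cases "({last p, hd q} \<notin> ?C \<and> {last q, hd p} \<notin> ?C) \<or> ({last p, last q} \<notin> ?C \<and> {hd q, hd p} \<notin> ?C)")
      case True
      then show ?thesis using now[OF H1(1) H2(1)] now[OF H1(2) H2(2)] by blast
    next
      case False
      then obtain x y where x: "x \<in> {{last p, hd q}, {last q, hd p}}" "x \<in> ?C"
        and y: "y \<in> {{last p, last q}, {hd q, hd p}}" "y \<in> ?C" by blast
      note pairs = closing_pairs[OF len cross x(1) y(1)]
      have "x \<noteq> y" by (rule pairs)
      have "x \<notin> B" "y \<notin> B" using x(1) y(1) crossB E by blast+
      \<comment> \<open>No Blue edge joined two ends before, so both blocking edges are the two new
        ones.\<close>
      then have xy: "{x, y} = {f, g}" using x(2) y(2) \<open>x \<noteq> y\<close> by blast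
      obtain v where v: "v \<in> x" "v \<in> y" "v \<in> ends F" using pairs(2) E by blast
      have was: "wasted n ?C"
      proof (cases "wasted n B")
        case True
        then show ?thesis by (rule wasted_mono) auto
      next
        case False
        then have "1 \<le> deg B v" using sp v by (auto simp: spoiled_def)
        moreover have "deg ?C v = deg B v + deg (?C - B) v" using C by (intro deg_diff) auto
        moreover have "{b \<in> ?C - B. v \<in> b} = {x, y}" using xy v \<open>x \<notin> B\<close> \<open>y \<notin> B\<close> by auto
        then have "deg (?C - B) v = 2" using \<open>x \<noteq> y\<close> by (simp add: deg_def)
        ultimately show ?thesis using not_wasted_deg_le[of n ?C v] by fastforce
      qed
      have ext: "forces ?X ?W 6 (Suc (Suc l)) ?R ?C"
        if "us \<noteq> []" "ws \<noteq> []" "distinct (us @ ws)" "set (us @ ws) = {..<n}" "pedges us \<union> pedges ws = ?R"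
          "hd us \<in> ends F" "last ws \<in> ends F" "{last us, hd ws} \<notin> ?R" "{last us, hd ws} \<notin> ?C" for us ws
        using that bd C cR RX was l4 n unfolding bounded_part_def
        by (intro forces_from_two_paths[where A = A and d = d]) auto
      show ?thesis
      proof (cases "x = {last p, hd q}")
        case True
        then have "{last q, hd p} \<notin> ?C"
          using pairs(3)[OF True] crossB[of "last q" "hd p"] unfolding xy E by simp
        moreover have "{last q, hd p} \<notin> ?R" using crossR mem by (metis insert_commute)
        \<comment> \<open>The order \<open>q\<close>, \<open>p\<close> makes the joining edge
          \<open>{last q, hd p}\<close>.\<close>
        ultimately show ?thesis using ne R E by (intro ext[of q p]) auto
      next
        case False
        then have "{last p, hd q} \<notin> ?C"
          using pairs(4)[OF False] crossB[of "last p" "hd q"] unfolding xy E by simp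
        moreover have "{last p, hd q} \<notin> ?R" using crossR mem by blast
        ultimately show ?thesis using ne R E by (intro ext[of p q]) auto
      qed
    qed
  qed
  have "forces ?X ?W (Suc (Suc 6)) l ?R B"
  proof (rule forces_blue)
    show "\<not> completed ?W B" using state_not_completed[OF s] n by simp
    show "?R \<union> B \<subset> ?X" using st RX n cR cB by (intro psubset_complete_edges) auto
    fix f assume f: "f \<in> ?X" "f \<notin> ?R" "f \<notin> B"
    show "forces ?X ?W (Suc 6) (Suc l) ?R (insert f B)"
    proof (rule forces_blue)
      show "\<not> completed ?W (insert f B)"
        using fin f cB by (intro not_completed_if_card_less) auto
      show "?R \<union> insert f B \<subset> ?X" using st RX n cR cB f fin by (intro psubset_complete_edges) auto
    qed (use turns main[OF f] in auto)
  qed (use turns in auto)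
  then show ?thesis unfolding win_def m by (simp add: numeral_eq_Suc)
qed

section \<open>The phases of Red's strategy\<close>

lemma joins_no_isos:
  assumes "joins n F u w F'" "isos F = {}"
  shows "ends F' = ends F - {u, w}" "isos F' = {}" "card F = Suc (card F')"
  using assms by (auto simp: joins_def)

lemma spoiled_mono:
  assumes "spoiled n F B" "ends F' \<subseteq> ends F" "B \<subseteq> C" "finite C"
  shows "spoiled n F' C"
  using assms wasted_mono[of n B C] deg_mono[of C B] unfolding spoiled_def
  by (meson le_trans subset_iff)

lemma bounded_part_mono:
  assumes "bounded_part A F B d" "ends F' \<subseteq> ends F" "B \<subseteq> C"
  shows "bounded_part A F' C d"
  using assms unfolding bounded_part_def by blast

lemma card_inner_insert_le:
  assumes "finite B"
  shows "card (inner (insert f B) E) \<le> Suc (card (inner B E))"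
proof -
  have "card (inner (insert f B) E) \<le> card (insert f (inner B E))"
    using assms by (intro card_mono) (auto simp: inner_def)
  also have "\<dots> \<le> Suc (card (inner B E))" by (rule card_insert_le_m1) auto
  finally show ?thesis .
qed

lemma state_finite: "state n l F B \<Longrightarrow> finite B"
  using finite_blue unfolding state_def by blast

lemma blue_turn_cases: "\<not> red_turn l \<Longrightarrow> l mod 4 = 2 \<and> Suc l mod 4 = 3 \<or> l mod 4 = 3 \<and> Suc l mod 4 = 0"
  unfolding red_turn_def by presburger

lemma red_turn_cases: "red_turn l \<Longrightarrow> l mod 4 = 0 \<and> Suc l mod 4 = 1 \<or> l mod 4 = 1 \<and> Suc l mod 4 = 2"
  unfolding red_turn_def by presburger

section \<open>Few Blue edges between ends: down to two paths\<close>

text \<open>\<open>g\<close> bounds the excess of \<open>e\<close> over \<open>k\<close>: a round can lower it by one while \<open>k\<close> drops by two,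
  whence the lower bound on \<open>k\<close> in terms of \<open>2 * g\<close>.\<close>

definition inv_sparse :: "nat \<Rightarrow> nat \<Rightarrow> nat \<Rightarrow> nat list set \<Rightarrow> nat set set \<Rightarrow> bool" where
  "inv_sparse n g l F B \<longleftrightarrow> isos F = {} \<and> spoiled n F B \<and> (\<exists>A d. bounded_part A F B d) \<and>
     card (inner B (ends F)) + lead l \<le> card F + g \<and>
     (g = 0 \<or> 2 * g + 12 + (if l mod 4 = 1 then 1 else 0) \<le> card F) \<and>
     (if l mod 4 = 1 then 3 else if l mod 4 = 2 then 2 else 4) \<le> card F"

lemma inv_sparse_join:
  assumes s: "state n l F B" and I: "inv_sparse n g l F B" and j: "joins n F u w F'"
    and e: "card (inner B (ends F - {u, w})) + lead (Suc l) \<le> card F - 1 + g'"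
    and g: "g' = 0 \<or> 2 * g' + 12 + (if Suc l mod 4 = 1 then 1 else 0) \<le> card F - 1"
    and k: "(if Suc l mod 4 = 1 then 3 else if Suc l mod 4 = 2 then 2 else 4) \<le> card F - 1"
  shows "inv_sparse n g' (Suc l) F' B"
proof -
  have "isos F = {}" using I by (simp add: inv_sparse_def)
  note jn = joins_no_isos[OF j this]
  have sub: "ends F' \<subseteq> ends F" using jn by blast
  have "spoiled n F' B" using I spoiled_mono[OF _ sub order_refl state_finite[OF s]]
    by (auto simp: inv_sparse_def)
  moreover have "\<exists>A d. bounded_part A F' B d"
    using I bounded_part_mono[OF _ sub order_refl] unfolding inv_sparse_def by blast
  ultimately show ?thesis using e g k jn unfolding inv_sparse_def by simp
qed

text \<open>Per round \<open>k\<close> falls by two and Blue adds at most two edges. Joins killing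
  two edges each thus preserve \<open>e \<le> k\<close>; as long as \<open>e > k\<close>, the first
  join of a move kills three and lowers \<open>g\<close>.\<close>

lemma win_sparse:
  assumes n: "n \<ge> 10" "even n"
  shows "state n l F B \<Longrightarrow> inv_sparse n g l F B \<Longrightarrow> win n l F B"
proof -
  define J where "J l F B \<longleftrightarrow> l mod 4 = 2 \<and> card F = 2 \<and> isos F = {} \<and> inner B (ends F) = {} \<and>
    spoiled n F B \<and> (\<exists>A d. bounded_part A F B d)" for l :: nat and F B
  define I where "I l F B \<longleftrightarrow> (\<exists>g. inv_sparse n g l F B)" for l :: nat and F B
  have "win n l F B" if "state n l F B" "I l F B" for l F B
  proof (rule phase[OF n(1), where I = I and J = J, OF _ _ _ that])
    fix l F B assume s: "state n l F B"
    note st = s[unfolded state_def]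
    { assume "J l F B" then show "win n l F B" using endgame[OF n(1) s] unfolding J_def by blast }
    assume "I l F B"
    then obtain g where I: "inv_sparse n g l F B" unfolding I_def by blast
    note Id = I[unfolded inv_sparse_def]
    let ?e = "card (inner B (ends F))" and ?k = "card F"
    { assume t: "red_turn l"
      have "\<exists>u w g'. legal F B u w \<and> card (inner B (ends F - {u, w})) + lead (Suc l) \<le> ?k - 1 + g' \<and>
        (g' = 0 \<or> 2 * g' + 12 + (if Suc l mod 4 = 1 then 1 else 0) \<le> ?k - 1) \<and>
        (if Suc l mod 4 = 1 then 3 else if Suc l mod 4 = 2 then 2 else 4) \<le> ?k - 1"
      proof (cases "l mod 4 = 0 \<and> g > 0 \<and> ?e \<ge> ?k + 1")
        case True
        then have "\<exists>u w. legal F B u w \<and> card (inner B (ends F - {u, w})) + 3 \<le> ?e"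
          using Id st by (intro join_drop3[of n]) (auto simp: lead_def)
        then obtain u w where "legal F B u w" "card (inner B (ends F - {u, w})) + 3 \<le> ?e" by blast
        moreover have "Suc l mod 4 = 1" using True by presburger
        ultimately show ?thesis using Id True
          by (intro exI[of _ u] exI[of _ w] exI[of _ "g - 1"]) (auto simp: lead_def)
      next
        case False
        have "\<exists>u w. legal F B u w \<and> card (inner B (ends F - {u, w})) \<le> ?e - 2"
          using Id st red_turn_cases[OF t] by (intro join_drop2[of n]) (auto simp: lead_def)
        then obtain u w where uw: "legal F B u w" "card (inner B (ends F - {u, w})) \<le> ?e - 2" by blast
        from red_turn_cases[OF t] show ?thesis
        proof
          assume t0: "l mod 4 = 0 \<and> Suc l mod 4 = 1"
          then have f: "4 \<le> ?k" "?e \<le> ?k + g" "g = 0 \<or> 2 * g + 12 \<le> ?k" "lead (Suc l) = 1"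
            using Id by (simp_all add: lead_def)
          \<comment> \<open>Either \<open>g = 0\<close>, or the case of a join killing three edges
            was left because \<open>e \<le> k\<close> already holds. So \<open>g\<close> may be
            lowered here as well.\<close>
          have "?e \<le> ?k" using False f(2) t0 by linarith
          then have "card (inner B (ends F - {u, w})) + 1 \<le> ?k - 1" using uw(2) f(1) by linarith
          then show ?thesis using uw(1) f t0
            by (intro exI[of _ u] exI[of _ w] exI[of _ "g - 1"] conjI) (simp, linarith, simp, linarith, simp)
        next
          assume t1: "l mod 4 = 1 \<and> Suc l mod 4 = 2"
          then have f: "3 \<le> ?k" "?e + 1 \<le> ?k + g" "g = 0 \<or> 13 + 2 * g \<le> ?k" "lead (Suc l) = 2"
            using Id by (simp_all add: lead_def)
          then have "card (inner B (ends F - {u, w})) + 2 \<le> ?k - 1 + g" using uw(2) by linarith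
          then show ?thesis using uw(1) f t1
            by (intro exI[of _ u] exI[of _ w] exI[of _ g] conjI) (simp, linarith, simp, linarith, simp)
        qed
      qed
      then show "J l F B \<or> (\<exists>u w. legal F B u w \<and> (\<forall>F'. joins n F u w F' \<longrightarrow> I (Suc l) F' B \<or> J (Suc l) F' B))"
        using inv_sparse_join[OF s I] unfolding I_def by blast
    }
    { assume t: "\<not> red_turn l"
      show "J l F B \<or> (\<forall>f\<in>complete_edges n - B. I (Suc l) F (insert f B) \<or> J (Suc l) F (insert f B))"
      proof (cases "l mod 4 = 2 \<and> ?k = 2")
        case True
        \<comment> \<open>\<open>k = 2\<close> forces \<open>g = 0\<close>, and the bound reads
          \<open>e + 2 \<le> 2\<close>.\<close>
        then have "?e = 0" using Id by (auto simp: lead_def)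
        then have "inner B (ends F) = {}" using state_finite[OF s] by (simp add: inner_def)
        then show ?thesis using True Id by (simp add: J_def)
      next
        case False
        have "?k \<ge> 4"
        proof (cases "l mod 4 = 2")
          case True
          then have "lead l = 2" by (simp add: lead_def)
          \<comment> \<open>Here the parity of \<open>n\<close> enters: after a Red move
            \<open>k\<close> is even, so it cannot skip the value two.\<close>
          then have "l + 2 + 2 * ?k = 2 * n" using st by linarith
          then have "even ?k" using True n(2) by presburger
          moreover have "?k \<ge> 2" "?k \<noteq> 2" using Id True False by auto
          ultimately show ?thesis by presburger
        next
          case False
          then show ?thesis using Id blue_turn_cases[OF t] by auto
        qed
        have "inv_sparse n g (Suc l) F (insert f B)" for f
        proof -
          have "spoiled n F (insert f B)"
            using Id spoiled_mono[of n F B F "insert f B"] state_finite[OF s] by blast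
          moreover have "\<exists>A d. bounded_part A F (insert f B) d"
            using Id bounded_part_mono[of _ F B _ F "insert f B"] by blast
          moreover have "card (inner (insert f B) (ends F)) + lead (Suc l) \<le> ?k + g"
            using Id card_inner_insert_le[OF state_finite[OF s], of f "ends F"] lead_Suc_blue[OF t] by simp
          ultimately show ?thesis
            using Id \<open>?k \<ge> 4\<close> blue_turn_cases[OF t] unfolding inv_sparse_def by auto
        qed
        then show ?thesis unfolding I_def by blast
      qed }
  qed
  then show "state n l F B \<Longrightarrow> inv_sparse n g l F B \<Longrightarrow> win n l F B" unfolding I_def by blast
qed

section \<open>Many Blue edges between ends\<close>

text \<open>Here a join kills four of the \<open>e\<close> edges.  The bound on \<open>d\<close> makes sure that an end of
  maximal Blue degree still has a legal partner: since \<open>A\<close>, Blue has added few edges.\<close>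

definition inv_dense :: "nat \<Rightarrow> nat \<Rightarrow> nat \<Rightarrow> nat list set \<Rightarrow> nat set set \<Rightarrow> bool" where
  "inv_dense n a l F B \<longleftrightarrow> isos F = {} \<and> spoiled n F B \<and>
     (\<exists>A d. bounded_part A F B d \<and> 2 * d + 2 * n \<le> 3 * a + 2 * card A) \<and>
     card (inner B (ends F)) + lead l + a \<le> 3 * card F"

text \<open>A join lowers \<open>3 * k\<close> by three and \<open>e + lead l\<close> by at least
  three, while a Blue step does not increase \<open>e + lead l\<close>. So the margin
  \<open>a\<close> persists, and while \<open>e + lead l > k + 8\<close> it gives
  \<open>2 * k > a + 8\<close>.\<close>

lemma win_dense:
  assumes n: "n \<ge> 10" "even n" and a: "a \<ge> 100"
  shows "state n l F B \<Longrightarrow> inv_dense n a l F B \<Longrightarrow> win n l F B"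
proof (erule phase[OF n(1), where I = "inv_dense n a" and J = "inv_sparse n 8", rotated 3])
  fix l F B assume s: "state n l F B"
  note st = s[unfolded state_def]
  { assume "inv_sparse n 8 l F B" then show "win n l F B" by (rule win_sparse[OF n s]) }
  assume I: "inv_dense n a l F B"
  note Id = I[unfolded inv_dense_def]
  let ?e = "card (inner B (ends F))" and ?k = "card F"
  obtain A d where A: "bounded_part A F B d" "2 * d + 2 * n \<le> 3 * a + 2 * card A" using Id by blast
  have iso: "isos F = {}" and Ie: "?e + lead l + a \<le> 3 * ?k" using Id by simp_all
  { assume t: "red_turn l"
    show "inv_sparse n 8 l F B \<or> (\<exists>u w. legal F B u w \<and>
      (\<forall>F'. joins n F u w F' \<longrightarrow> inv_dense n a (Suc l) F' B \<or> inv_sparse n 8 (Suc l) F' B))"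
    proof (cases "?e + lead l \<le> ?k + 8")
      case True
      then have "29 \<le> ?k" using Ie a by linarith
      then show ?thesis using Id A True unfolding inv_sparse_def by auto
    next
      case False
      have "lead l \<le> 1" using red_turn_cases[OF t] by (auto simp: lead_def)
      have fin: "finite B" by (rule state_finite[OF s])
      have "\<exists>u w. legal F B u w \<and> card (inner B (ends F - {u, w})) + 4 \<le> ?e"
      proof (rule join_drop4[of n])
        show "?k + 8 \<le> ?e" using False \<open>lead l \<le> 1\<close> by linarith
        fix v assume v: "v \<in> ends F"
        have AB: "A \<subseteq> B" "finite A" using A(1) fin by (auto simp: bounded_part_def intro: finite_subset)
        have "deg (inner B (ends F)) v \<le> deg B v" using fin by (intro deg_mono) (auto simp: inner_def)
        also have "\<dots> = deg A v + deg (B - A) v" using AB fin by (intro deg_diff) auto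
        also have "deg A v \<le> d" using A(1) v by (simp add: bounded_part_def)
        also have "deg (B - A) v \<le> card (B - A)" using fin by (intro deg_le_card) auto
        also have "card (B - A) = card B - card A" using AB by (intro card_Diff_subset) auto
        finally have "deg (inner B (ends F)) v \<le> d + (card B - card A)" by simp
        then have "deg (inner B (ends F)) v + card A \<le> d + card B"
          using card_mono[OF fin AB(1)] by linarith
        moreover have "card B + ?k \<le> n" using st by linarith
        \<comment> \<open>The degree is at most \<open>d + n - k - card A\<close>; the choice of
          \<open>a\<close> bounds \<open>d + n - card A\<close> by \<open>3 * a / 2\<close>, which
          is less than \<open>3 * k - 3\<close> by the margin.\<close>
        ultimately show "deg (inner B (ends F)) v + 3 \<le> 2 * ?k"
          using A(2) Ie False by linarith
      qed (use st Id in auto)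
      then obtain u w where uw: "legal F B u w" "card (inner B (ends F - {u, w})) + 4 \<le> ?e" by blast
      have "inv_dense n a (Suc l) F' B" if j: "joins n F u w F'" for F'
      proof -
        note jn = joins_no_isos[OF j iso]
        have sub: "ends F' \<subseteq> ends F" using jn by blast
        have "spoiled n F' B" using Id spoiled_mono[OF _ sub order_refl fin] by blast
        moreover have "bounded_part A F' B d" by (rule bounded_part_mono[OF A(1) sub order_refl])
        moreover have "card (inner B (ends F')) + lead (Suc l) + a \<le> 3 * card F'"
          using uw(2) jn Id lead_Suc_red[OF t] by simp
        ultimately show ?thesis using A(2) jn unfolding inv_dense_def by blast
      qed
      then show ?thesis using uw(1) by blast
    qed }
  { assume t: "\<not> red_turn l"
    have "inv_dense n a (Suc l) F (insert f B)" for f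
    proof -
      have "spoiled n F (insert f B)"
        using Id spoiled_mono[of n F B F "insert f B"] state_finite[OF s] by blast
      moreover have "bounded_part A F (insert f B) d" using bounded_part_mono[OF A(1)] by blast
      moreover have "card (inner (insert f B) (ends F)) + lead (Suc l) + a \<le> 3 * ?k"
        using Ie card_inner_insert_le[OF state_finite[OF s], of f "ends F"] lead_Suc_blue[OF t] by linarith
      ultimately show ?thesis using A(2) iso unfolding inv_dense_def by blast
    qed
    then show "inv_sparse n 8 l F B \<or> (\<forall>f\<in>complete_edges n - B.
      inv_dense n a (Suc l) F (insert f B) \<or> inv_sparse n 8 (Suc l) F (insert f B))" by blast }
qed

section \<open>Removing ends untouched by Blue\<close>

definition untouched :: "nat list set \<Rightarrow> nat set set \<Rightarrow> nat set" where
  "untouched F B = {v \<in> ends F. deg B v = 0}"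

text \<open>A join at an untouched end lowers both the right side and the terms with
  \<open>untouched F B\<close> by at least two. So about \<open>n / 10\<close> paths remain when no
  such end is left.\<close>

definition inv_untouched :: "nat \<Rightarrow> nat \<Rightarrow> nat list set \<Rightarrow> nat set set \<Rightarrow> bool" where
  "inv_untouched n l F B \<longleftrightarrow> isos F = {} \<and> \<not> wasted n B \<and>
     n div 5 + card (untouched F B) + min (card (untouched F B)) 2 \<le> 2 * card F"

lemma card_inner_not_wasted_le:
  assumes "forest n F" "B \<subseteq> complete_edges n" "isos F = {}" "\<not> wasted n B"
  shows "card (inner B (ends F)) \<le> 2 * card F"
proof -
  have fin: "finite B" using finite_blue assms(2) .
  have "2 * card (inner B (ends F)) = (\<Sum>v\<in>ends F. deg (inner B (ends F)) v)"
    using sum_deg_inner assms by simp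
  also have "\<dots> \<le> of_nat (card (ends F)) * 2"
  proof (rule sum_bounded_above)
    show "deg (inner B (ends F)) v \<le> 2" for v
      using deg_mono[OF fin, of "inner B (ends F)" v] not_wasted_deg_le[OF assms(4), of v]
      by (force simp: inner_def)
  qed
  finally show ?thesis using card_ends_isos[OF assms(1)] assms(3) by simp
qed

text \<open>Degrees are at most two, so there are at least as many touched vertices as Blue edges.
  Since Blue has about \<open>n - k\<close> edges, at most about half of the \<open>2 * k\<close>
  ends are untouched.\<close>

lemma card_untouched_le:
  assumes "forest n F" "B \<subseteq> complete_edges n" "\<not> wasted n B"
  shows "card (untouched F B) + card B \<le> n"
proof -
  have E: "ends F \<subseteq> {..<n}" using ends_subset assms(1) by blast
  have fin: "finite B" using finite_blue assms(2) .
  have U: "untouched F B \<subseteq> {..<n}" using E by (auto simp: untouched_def)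
  have "2 * card B = (\<Sum>v<n. deg B v)"
    using assms(2) fin by (intro sum_deg[symmetric]) (auto simp: complete_edges_def)
  also have "\<dots> = (\<Sum>v\<in>{..<n} - untouched F B. deg B v) + (\<Sum>v\<in>untouched F B. deg B v)"
    using U by (intro sum.subset_diff) auto
  also have "(\<Sum>v\<in>untouched F B. deg B v) = 0" by (simp add: untouched_def)
  also have "(\<Sum>v\<in>{..<n} - untouched F B. deg B v) \<le> of_nat (card ({..<n} - untouched F B)) * 2"
    using not_wasted_deg_le[OF assms(3)] by (intro sum_bounded_above)
  also have "card ({..<n} - untouched F B) = n - card (untouched F B)"
    using U by (subst card_Diff_subset) (auto intro: finite_subset)
  finally have "card B \<le> n - card (untouched F B)" by simp
  moreover have "card (untouched F B) \<le> n" using card_mono[OF _ U] by simp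
  ultimately show ?thesis by simp
qed

text \<open>\<open>C\<close> is \<open>B\<close>, or \<open>B\<close> with the edge by which Blue
  wastes a step. Degrees are at most two in \<open>B\<close>, which is taken as the bounded part
  with \<open>d = 2\<close>; \<open>e \<le> 2 * k\<close> leaves the margin
  \<open>a = k - 5\<close>.\<close>

lemma inv_dense_start:
  assumes n: "n \<ge> 2000" and s: "state n l F B" and iso: "isos F = {}" and w: "\<not> wasted n B"
    and k: "n div 5 \<le> 2 * card F" and C: "spoiled n F C" "B \<subseteq> C"
      "card (inner C (ends F)) \<le> Suc (card (inner B (ends F)))" "lead l' \<le> 2"
  shows "\<exists>a\<ge>100. inv_dense n a l' F C"
proof -
  note st = s[unfolded state_def]
  have "2 * card F \<le> n"
    using card_ends_isos[of n F] st iso card_mono[OF _ ends_subset[of n F]] by simp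
  moreover have "lead l \<le> 2" by (simp add: lead_def)
  ultimately have B: "n \<le> card B + card F + 2" "14 \<le> card B" using st n by linarith+
  have kk: "105 \<le> card F" using k n by presburger
  have "bounded_part B F C 2"
    using C(2) B not_wasted_deg_le[OF w] by (auto simp: bounded_part_def)
  moreover have "2 * 2 + 2 * n \<le> 3 * (card F - 5) + 2 * card B"
    using B kk k by linarith
  moreover have "card (inner C (ends F)) + lead l' + (card F - 5) \<le> 3 * card F"
    using card_inner_not_wasted_le[of n F B] st iso w C kk by linarith
  ultimately have "inv_dense n (card F - 5) l' F C" unfolding inv_dense_def using iso C(1) by blast
  moreover have "card F - 5 \<ge> 100" using kk by simp
  ultimately show ?thesis by blast
qed

text \<open>The last two untouched ends may belong to the same path, so they are handled one by one;
  this is what the summand \<open>min (card (untouched F B)) 2\<close> pays for.\<close>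

lemma untouched_join:
  assumes F: "forest n F" and B: "finite B" and E: "3 \<le> card (ends F)" and u: "u \<in> untouched F B"
  shows "\<exists>w. legal F B u w \<and> card (untouched F B - {u, w}) + min (card (untouched F B - {u, w})) 2 + 2
    \<le> card (untouched F B) + min (card (untouched F B)) 2"
proof -
  let ?U = "untouched F B"
  have fin: "finite ?U" using finite_ends[OF F] by (simp add: untouched_def)
  have uE: "u \<in> ends F" and "deg B u = 0" using u by (auto simp: untouched_def)
  then have d: "deg (inner B (ends F)) u = 0"
    using deg_mono[OF B, of "inner B (ends F)" u] by (force simp: inner_def)
  show ?thesis
  proof (cases "card ?U \<ge> 3")
    case True
    \<comment> \<open>Without Blue neighbours, \<open>u\<close> excludes at most itself and the
      other end of its path, so one of three untouched ends is a legal partner.\<close>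
    have "\<not> ?U \<subseteq> ends F - {w. legal F B u w}"
    proof
      assume "?U \<subseteq> ends F - {w. legal F B u w}"
      then have "card ?U \<le> card (ends F - {w. legal F B u w})"
        using finite_ends[OF F] by (intro card_mono) auto
      then show False using card_illegal_le[OF F B uE] True d by simp
    qed
    then obtain w where w: "w \<in> ?U" "legal F B u w" by (auto simp: untouched_def)
    have "u \<noteq> w" using legal_neq[OF F w(2)] .
    then have "card (?U - {u, w}) = card ?U - 2" using w(1) u fin by (simp add: card_Diff_subset)
    then show ?thesis using w(2) True by (intro exI[of _ w]) auto
  next
    case False
    obtain w where w: "legal F B u w" using legal_exists[OF F B uE] d E by auto
    have "card (?U - {u, w}) \<le> card (?U - {u})" using fin by (intro card_mono) auto
    also have "\<dots> = card ?U - 1" using u by simp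
    finally have "card (?U - {u, w}) \<le> card ?U - 1" .
    moreover have "card ?U > 0" using u fin by (auto simp: card_gt_0_iff)
    ultimately show ?thesis using w False by (intro exI[of _ w]) auto
  qed
qed

text \<open>Two exits: Blue wastes an edge, or no untouched end is left. Both make the position
  \<open>spoiled\<close>.\<close>

lemma win_untouched:
  assumes n: "n \<ge> 2000" "even n"
  shows "state n l F B \<Longrightarrow> inv_untouched n l F B \<Longrightarrow> win n l F B"
proof (erule phase[where I = "inv_untouched n" and J = "\<lambda>l F B. \<exists>a\<ge>100. inv_dense n a l F B", rotated 4])
  show "n \<ge> 10" using n by simp
  fix l F B assume s: "state n l F B"
  note st = s[unfolded state_def]
  have fin: "finite B" by (rule state_finite[OF s])
  { assume "\<exists>a\<ge>100. inv_dense n a l F B" then show "win n l F B" using win_dense n s by fastforce }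
  assume I: "inv_untouched n l F B"
  have iso: "isos F = {}" and was: "\<not> wasted n B"
    and z: "n div 5 + card (untouched F B) + min (card (untouched F B)) 2 \<le> 2 * card F"
    using I by (simp_all add: inv_untouched_def)
  have k: "n div 5 \<le> 2 * card F" using z by linarith
  have lead: "lead m \<le> 2" for m by (simp add: lead_def)
  { assume t: "red_turn l"
    show "(\<exists>a\<ge>100. inv_dense n a l F B) \<or> (\<exists>u w. legal F B u w \<and>
      (\<forall>F'. joins n F u w F' \<longrightarrow> inv_untouched n (Suc l) F' B \<or> (\<exists>a\<ge>100. inv_dense n a (Suc l) F' B)))"
    proof (cases "untouched F B = {}")
      case True
      then have "spoiled n F B" by (force simp: untouched_def spoiled_def)
      then have "\<exists>a\<ge>100. inv_dense n a l F B"
        using lead by (intro inv_dense_start[OF n(1) s iso was k]) auto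
      then show ?thesis by blast
    next
      case False
      then obtain u where u: "u \<in> untouched F B" by blast
      have "3 \<le> card (ends F)" using card_ends_isos[of n F] st iso k n by simp
      then obtain w where w: "legal F B u w"
        "card (untouched F B - {u, w}) + min (card (untouched F B - {u, w})) 2 + 2
          \<le> card (untouched F B) + min (card (untouched F B)) 2"
        using untouched_join[of n F B u] st fin u by blast
      have "inv_untouched n (Suc l) F' B" if j: "joins n F u w F'" for F'
      proof -
        note jn = joins_no_isos[OF j iso]
        have "untouched F' B = untouched F B - {u, w}" using jn by (auto simp: untouched_def)
        then show ?thesis using w(2) jn z was unfolding inv_untouched_def by simp
      qed
      then show ?thesis using w(1) by blast
    qed }
  { assume t: "\<not> red_turn l"
    have "inv_untouched n (Suc l) F (insert f B) \<or> (\<exists>a\<ge>100. inv_dense n a (Suc l) F (insert f B))" for f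
    proof (cases "wasted n (insert f B)")
      case True
      then show ?thesis
        using inv_dense_start[OF n(1) s iso was k, of "insert f B" "Suc l"] lead
          card_inner_insert_le[OF fin] by (auto simp: spoiled_def)
    next
      case False
      have "card (untouched F (insert f B)) \<le> card (untouched F B)"
        using st finite_ends[of n F] deg_mono[of "insert f B" B] fin
        by (intro card_mono) (auto simp: untouched_def, metis bot_nat_0.extremum_uniqueI subset_insertI)
      then have "inv_untouched n (Suc l) F (insert f B)"
        using z False iso unfolding inv_untouched_def by auto
      then show ?thesis by blast
    qed
    then show "(\<exists>a\<ge>100. inv_dense n a l F B) \<or> (\<forall>f\<in>complete_edges n - B.
      inv_untouched n (Suc l) F (insert f B) \<or> (\<exists>a\<ge>100. inv_dense n a (Suc l) F (insert f B)))" by blast }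
qed

section \<open>Removing ends of linear Blue degree\<close>

text \<open>\<open>K\<close> collects the heavy vertices that Red has made interior. Joining at
  another one adds it to \<open>K\<close> and costs one path, which balances in the last inequality;
  since \<open>K\<close> stays small, hardly any paths are used up.\<close>

definition inv_heavy :: "nat \<Rightarrow> nat \<Rightarrow> nat list set \<Rightarrow> nat set set \<Rightarrow> bool" where
  "inv_heavy n l F B \<longleftrightarrow> isos F = {} \<and> (\<exists>K\<subseteq>{..<n}. K \<inter> ends F = {} \<and>
     (\<forall>v\<in>K. n div 8 \<le> deg B v) \<and> n \<le> 2 * card F + 2 * card K + n div 20)"

text \<open>Seventeen vertices of degree about \<open>n / 8\<close> would exceed the degree sum,
  which is at most \<open>2 * n\<close>.\<close>

lemma card_heavy_le:
  assumes "n \<ge> 2000" "B \<subseteq> complete_edges n" "card B \<le> n" "K \<subseteq> {..<n}" "\<And>v. v \<in> K \<Longrightarrow> n div 8 \<le> deg B v"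
  shows "card K \<le> 16"
proof (rule ccontr)
  assume "\<not> card K \<le> 16"
  then have "17 * (n div 8) \<le> card K * (n div 8)" by (intro mult_right_mono) auto
  also have "\<dots> \<le> (\<Sum>v\<in>K. deg B v)" using sum_bounded_below[of K "n div 8" "deg B"] assms(5) by simp
  also have "\<dots> \<le> 2 * n" using sum_deg_le[OF assms(2,4)] assms(3) by linarith
  finally have "17 * (n div 8) \<le> 2 * n" .
  moreover have "n < 8 * (n div 8) + 8" by presburger
  ultimately show False using assms(1) by linarith
qed

lemma win_heavy:
  assumes n: "n \<ge> 2000" "even n"
  shows "state n l F B \<Longrightarrow> inv_heavy n l F B \<Longrightarrow> win n l F B"
proof (erule phase[where I = "inv_heavy n" and
      J = "\<lambda>l F B. inv_untouched n l F B \<or> (\<exists>a\<ge>100. inv_dense n a l F B)", rotated 4])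
  show "n \<ge> 10" using n by simp
  fix l F B assume s: "state n l F B"
  note st = s[unfolded state_def]
  have fin: "finite B" by (rule state_finite[OF s])
  { assume "inv_untouched n l F B \<or> (\<exists>a\<ge>100. inv_dense n a l F B)"
    then show "win n l F B" using win_dense win_untouched n s by fastforce }
  assume I: "inv_heavy n l F B"
  then have iso: "isos F = {}" by (simp add: inv_heavy_def)
  obtain K where K: "K \<subseteq> {..<n}" "K \<inter> ends F = {}" "\<And>v. v \<in> K \<Longrightarrow> n div 8 \<le> deg B v"
    "n \<le> 2 * card F + 2 * card K + n div 20" using I unfolding inv_heavy_def by blast
  have B: "card B + card F + lead l = n" "lead l \<le> 2" using st by (auto simp: lead_def)
  have "card B \<le> n" using B by linarith
  moreover have "B \<subseteq> complete_edges n" using st by blast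
  ultimately have "card K \<le> 16" using card_heavy_le[OF n(1) _ _ K(1,3)] by blast
  then have k: "n \<le> 2 * card F + 32 + n div 20" using K(4) by linarith
  have E: "card (ends F) = 2 * card F" using card_ends_isos[of n F] st iso by simp
  moreover have "card (ends F) \<le> n" using card_mono[OF _ ends_subset[of n F]] st by simp
  ultimately have k2: "2 * card F \<le> n" by simp
  { assume t: "red_turn l"
    show "(inv_untouched n l F B \<or> (\<exists>a\<ge>100. inv_dense n a l F B)) \<or> (\<exists>u w. legal F B u w \<and>
      (\<forall>F'. joins n F u w F' \<longrightarrow> inv_heavy n (Suc l) F' B \<or>
        inv_untouched n (Suc l) F' B \<or> (\<exists>a\<ge>100. inv_dense n a (Suc l) F' B)))"
    proof (cases "\<exists>v\<in>ends F. n div 8 \<le> deg B v")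
      case True
      then obtain v where v: "v \<in> ends F" "n div 8 \<le> deg B v" by blast
      have "deg (inner B (ends F)) v \<le> card B"
        using deg_mono[OF fin, of "inner B (ends F)" v] deg_le_card[OF fin, of v] by (force simp: inner_def)
      then have "deg (inner B (ends F)) v + 3 \<le> card (ends F)"
        unfolding E using B k n by linarith
      then obtain w where w: "legal F B v w" using legal_exists[of n F B v] st fin v by blast
      have "inv_heavy n (Suc l) F' B" if j: "joins n F v w F'" for F'
      proof -
        note jn = joins_no_isos[OF j iso]
        have "v < n" using v st ends_subset by blast
        moreover have "v \<notin> K" "finite K" using K v finite_subset by blast+
        ultimately show ?thesis
          unfolding inv_heavy_def using K v(2) jn by (intro conjI exI[of _ "insert v K"]) auto
      qed
      then show ?thesis using w by blast
    next
      case False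
      show ?thesis
      proof (cases "wasted n B")
        case True
        have "bounded_part B F B (n div 8)"
          using False B k2 n by (auto simp: bounded_part_def)
        \<comment> \<open>The margin \<open>a = 4 * k - n\<close> comes from
          \<open>e + lead l \<le> card B + lead l = n - k\<close>.\<close>
        moreover have "2 * (n div 8) + 2 * n \<le> 3 * (4 * card F - n) + 2 * card B"
          using B k n by linarith
        moreover have "card (inner B (ends F)) \<le> card B"
          using fin by (intro card_mono) (auto simp: inner_def)
        then have "card (inner B (ends F)) + lead l + (4 * card F - n) \<le> 3 * card F"
          using B k n by linarith
        ultimately have "inv_dense n (4 * card F - n) l F B"
          using iso True unfolding inv_dense_def spoiled_def by blast
        moreover have "4 * card F - n \<ge> 100" using k n by linarith
        ultimately show ?thesis by blast
      next
        case False
        have "card (untouched F B) + card B \<le> n" using card_untouched_le[of n F B] st False by blast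
        then have "n div 5 + card (untouched F B) + min (card (untouched F B)) 2 \<le> 2 * card F"
          using B k n by linarith
        then show ?thesis using False iso by (simp add: inv_untouched_def)
      qed
    qed }
  { assume t: "\<not> red_turn l"
    have "inv_heavy n (Suc l) F (insert f B)" for f
    proof -
      have "n div 8 \<le> deg (insert f B) v" if "v \<in> K" for v
        using K(3)[OF that] deg_mono[of "insert f B" B v] fin by (meson finite_insert le_trans subset_insertI)
      then show ?thesis unfolding inv_heavy_def using iso K by blast
    qed
    then show "(inv_untouched n l F B \<or> (\<exists>a\<ge>100. inv_dense n a l F B)) \<or> (\<forall>f\<in>complete_edges n - B.
      inv_heavy n (Suc l) F (insert f B) \<or>
      inv_untouched n (Suc l) F (insert f B) \<or> (\<exists>a\<ge>100. inv_dense n a (Suc l) F (insert f B)))" by blast }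
qed

section \<open>Removing isolated vertices\<close>

text \<open>With many isolated vertices Red joins two of them, which preserves the first inequality;
  it holds with equality at the start. Once at most \<open>n div 20\<close> are left, it implies the
  second, which survives joining an isolated vertex to any end.\<close>

definition inv_isos :: "nat \<Rightarrow> nat \<Rightarrow> nat list set \<Rightarrow> nat set set \<Rightarrow> bool" where
  "inv_isos n l F B \<longleftrightarrow> n + card (isos F) \<le> 2 * card F \<or>
     n + 2 * card (isos F) \<le> 2 * card F + n div 20"

lemma not_connected_isos:
  assumes "forest n F" "u \<in> isos F" "w \<noteq> u"
  shows "\<not> connected F u w"
proof
  assume "connected F u w"
  then obtain p where p: "p \<in> F" "u \<in> set p" "w \<in> set p" by (auto simp: connected_def)
  have "p = [u]"
  proof (rule ccontr)
    assume "p \<noteq> [u]"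
    moreover have "[u] \<in> F" using assms(2) by (simp add: isos_def)
    ultimately have "set p \<inter> set [u] = {}" using assms(1) p(1) unfolding forest_def by blast
    then show False using p by simp
  qed
  then show False using p assms(3) by simp
qed

lemma win_isos:
  assumes n: "n \<ge> 2000" "even n"
  shows "state n l F B \<Longrightarrow> inv_isos n l F B \<Longrightarrow> win n l F B"
proof (erule phase[where I = "inv_isos n" and J = "inv_heavy n", rotated 4])
  show "n \<ge> 10" using n by simp
  fix l F B assume s: "state n l F B"
  note st = s[unfolded state_def]
  have fin: "finite B" by (rule state_finite[OF s])
  { assume "inv_heavy n l F B" then show "win n l F B" using win_heavy n s by blast }
  assume I: "inv_isos n l F B"
  have F: "forest n F" using st by blast
  have finI: "finite (isos F)" by (rule finite_subset[OF isos_subset_ends finite_ends[OF F]])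
  have B: "card B + card F \<le> n" using st by linarith
  have E: "card (ends F) + card (isos F) = 2 * card F" by (rule card_ends_isos[OF F])
  { assume t: "red_turn l"
    show "inv_heavy n l F B \<or> (\<exists>u w. legal F B u w \<and>
      (\<forall>F'. joins n F u w F' \<longrightarrow> inv_isos n (Suc l) F' B \<or> inv_heavy n (Suc l) F' B))"
    proof (cases "isos F = {}")
      case True
      then have "n \<le> 2 * card F + 2 * card {} + n div 20" using I unfolding inv_isos_def by auto
      then have "inv_heavy n l F B" unfolding inv_heavy_def using True by blast
      then show ?thesis by blast
    next
      case ne: False
      show ?thesis
      proof (cases "n + 2 * card (isos F) \<le> 2 * card F + n div 20")
        case True
        obtain u where u: "u \<in> isos F" using ne by blast
        then have uE: "u \<in> ends F" using isos_subset_ends[of F] by blast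
        have "deg (inner B (ends F)) u \<le> card B"
          using deg_mono[OF fin, of "inner B (ends F)" u] deg_le_card[OF fin, of u] by (force simp: inner_def)
        then have "deg (inner B (ends F)) u + 3 \<le> card (ends F)" using E B True n by linarith
        then obtain w where w: "legal F B u w" using legal_exists[OF F fin uE] by blast
        have "inv_isos n (Suc l) F' B" if j: "joins n F u w F'" for F'
        proof -
          have "card (isos F') \<le> card (isos F - {u})"
            using j finI by (intro card_mono) (auto simp: joins_def)
          also have "\<dots> = card (isos F) - 1" using u by simp
          finally have "card (isos F') + 1 \<le> card (isos F)" using u finI card_gt_0_iff[of "isos F"] ne by linarith
          moreover have "card F = Suc (card F')" using j by (simp add: joins_def)
          ultimately show ?thesis using True unfolding inv_isos_def by linarith
        qed
        then show ?thesis using w by blast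
      next
        case False
        then have i: "n + card (isos F) \<le> 2 * card F" "n div 20 < card (isos F)"
          using I n unfolding inv_isos_def by linarith+
        \<comment> \<open>Otherwise Blue would own all pairs of more than \<open>n div 20\<close>
          vertices, far more than his at most \<open>n\<close> edges.\<close>
        have "\<exists>u\<in>isos F. \<exists>w\<in>isos F. u \<noteq> w \<and> {u, w} \<notin> B"
        proof (rule ccontr)
          assume "\<not> ?thesis"
          then have "{b. b \<subseteq> isos F \<and> card b = 2} \<subseteq> B" by (auto simp: card_2_iff)
          then have "card {b. b \<subseteq> isos F \<and> card b = 2} \<le> card B" using fin by (rule card_mono[rotated])
          then have "card (isos F) choose 2 \<le> n" using n_subsets[OF finI, of 2] B by linarith
          then have "card (isos F) * (card (isos F) - 1) div 2 \<le> n" by (simp add: choose_two)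
          then have "card (isos F) * (card (isos F) - 1) \<le> 2 * n + 1" by linarith
          \<comment> \<open>The factor \<open>100\<close> uses \<open>n div 20 \<ge> 100\<close>,
            that is, the threshold \<open>2000\<close>.\<close>
          moreover have "n div 20 * 100 \<le> card (isos F) * (card (isos F) - 1)"
            using i(2) n by (intro mult_mono) auto
          ultimately show False using n by linarith
        qed
        then obtain u w where uw: "u \<in> isos F" "w \<in> isos F" "u \<noteq> w" "{u, w} \<notin> B" by blast
        have "legal F B u w"
          unfolding legal_def using uw not_connected_isos[OF F uw(1), of w] isos_subset_ends[of F] by auto
        moreover have "inv_isos n (Suc l) F' B" if j: "joins n F u w F'" for F'
        proof -
          have "card (isos F') = card (isos F) - 2"
            using j uw finI by (simp add: joins_def card_Diff_subset)
          moreover have "card F = Suc (card F')" using j by (simp add: joins_def)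
          moreover have "card (isos F) \<ge> 2" using i(2) n by linarith
          ultimately show ?thesis using i(1) unfolding inv_isos_def by linarith
        qed
        ultimately show ?thesis by blast
      qed
    qed }
  { assume t: "\<not> red_turn l"
    show "inv_heavy n l F B \<or> (\<forall>f\<in>complete_edges n - B.
      inv_isos n (Suc l) F (insert f B) \<or> inv_heavy n (Suc l) F (insert f B))"
      using I by (auto simp: inv_isos_def) }
qed

lemma win_start:
  assumes n: "n \<ge> 2000" "even n"
  shows "win n 0 ((\<lambda>v. [v]) ` {..<n}) {}"
proof (rule win_isos[OF n])
  let ?F = "(\<lambda>v. [v]) ` {..<n}"
  have c: "card ?F = n" by (simp add: card_image inj_on_def)
  have "red ?F = {}" by (auto simp: red_def)
  then show "state n 0 ?F {}" using c by (auto simp: state_def forest_def lead_def)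
  have "isos ?F = {..<n}" by (auto simp: isos_def)
  then show "inv_isos n 0 ?F {}" using c by (simp add: inv_isos_def)
qed

theorem theorem1p5:
  shows "\<exists>n0::nat. \<forall>n\<ge>n0. even n \<longrightarrow>
    (\<exists>\<sigma>. red_strategy (complete_edges n) (hamilton_cycles n) \<sigma> \<and>
      (\<forall>\<tau>. blue_strategy (complete_edges n) (hamilton_cycles n) \<tau> \<longrightarrow>
        red_wins_within (complete_edges n) (hamilton_cycles n) (n div 2 + 1) \<sigma> \<tau>))"
proof (intro exI[of _ 2000] allI impI)
  fix n :: nat assume n: "2000 \<le> n" "even n"
  have "red ((\<lambda>v. [v]) ` {..<n}) = {}" by (auto simp: red_def)
  then have "forces (complete_edges n) (hamilton_cycles n) (2 * n + 2) 0 {} {}"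
    using win_start[OF n] by (simp add: win_def)
  moreover have "4 * (n div 2 + 1) - 2 = 2 * n + 2" using n(2) by auto
  ultimately show "\<exists>\<sigma>. red_strategy (complete_edges n) (hamilton_cycles n) \<sigma> \<and>
      (\<forall>\<tau>. blue_strategy (complete_edges n) (hamilton_cycles n) \<tau> \<longrightarrow>
        red_wins_within (complete_edges n) (hamilton_cycles n) (n div 2 + 1) \<sigma> \<tau>)"
    unfolding red_wins_within_def using forces_imp_strategy by metis
qed

end
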